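(* Let $\mathbb{C}$ be a pointed Mal'tsev category in which a morphism is a monomorphism if and only if its kernel is $0$. Let $k:X\to A$ and $l:Y\to A$ be Bourn-normal monomorphisms in $\mathbb{C}$ with the same codomain. If $k$ and $l$ have trivial pullback (i.e. $X\times_A Y\cong 0$), then $k$ and $l$ Huq-commute and their cooperator $\varphi:X\times Y\to A$ is a Bourn-normal monomorphism which is also the join of $k$ and $l$ (as subobjects of $A$).
   Context: A Mal'tsev category is a finitely complete category in which every internal reflexive relation is an equivalence relation. In a pointed category, $0$ denotes the zero object and also every zero morphism. (Pointed Mal'tsev categories are unital: they are pointed, finitely complete, and for all objects $X,Y$ the morphisms $\langle 1,0\rangle:X\to X\times Y$ and $\langle 0,1\rangle:Y\to X\times Y$ are jointly strongly epimorphic.) Morphisms $f:X\to A$ and $g:Y\to A$ in a unital category Huq-commute (or simply commute) if there is a (necessarily unique) morphism $\varphi:X\times Y\to A$ with $\varphi\langle 1,0\rangle=f$ and $\varphi\langle 0,1\rangle=g$; $\varphi$ is called the cooperator of $f$ and $g$. A monomorphism $k:X\to A$ in a pointed finitely complete category is Bourn-normal if it is the zero class of an internal equivalence relation, i.e. there are an equivalence relation $r_1,r_2:R\to A$ and a morphism $\kappa:X\to R$ such that $\langle r_1,r_2\rangle\kappa=\langle 1,0\rangle k$ and this square is a pullback (of $\langle r_1,r_2\rangle:R\to A\times A$ along $\langle 1,0\rangle:A\to A\times A$). *)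

theory Defs
  imports Main
begin

section \<open>Categories and finite limits\<close>

record ('o, 'a) category =
  Obj :: "'o set"
  Arr :: "'a set"
  Dom :: "'a \<Rightarrow> 'o"
  Cod :: "'a \<Rightarrow> 'o"
  Id :: "'o \<Rightarrow> 'a"
  Comp :: "'a \<Rightarrow> 'a \<Rightarrow> 'a"  (infixr \<open>\<cdot>\<index>\<close> 70)

text \<open>Composition is in applicative order: \<open>g \<cdot>\<^bsub>C\<^esub> f\<close> is ``first \<open>f\<close>, then \<open>g\<close>''. Nothing is
  assumed about the values of the operations outside their domains.\<close>

definition Hom :: "('o, 'a) category \<Rightarrow> 'o \<Rightarrow> 'o \<Rightarrow> 'a set" where
  "Hom C A B = {f \<in> Arr C. Dom C f = A \<and> Cod C f = B}"

locale category =
  fixes C :: "('o, 'a) category" (structure)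
  assumes Dom_in_Obj: "f \<in> Arr C \<Longrightarrow> Dom C f \<in> Obj C"
    and Cod_in_Obj: "f \<in> Arr C \<Longrightarrow> Cod C f \<in> Obj C"
    and Id_in_Hom: "A \<in> Obj C \<Longrightarrow> Id C A \<in> Hom C A A"
    and Comp_in_Hom: "f \<in> Hom C A B \<Longrightarrow> g \<in> Hom C B D \<Longrightarrow> g \<cdot> f \<in> Hom C A D"
    and Comp_Id: "f \<in> Hom C A B \<Longrightarrow> f \<cdot> Id C A = f"
    and Id_Comp: "f \<in> Hom C A B \<Longrightarrow> Id C B \<cdot> f = f"
    and Comp_assoc: "f \<in> Hom C A B \<Longrightarrow> g \<in> Hom C B D \<Longrightarrow> h \<in> Hom C D E \<Longrightarrow>
      (h \<cdot> g) \<cdot> f = h \<cdot> (g \<cdot> f)"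

definition is_functor ::
  "('p, 'b) category \<Rightarrow> ('o, 'a) category \<Rightarrow> ('p \<Rightarrow> 'o) \<Rightarrow> ('b \<Rightarrow> 'a) \<Rightarrow> bool" where
  "is_functor J C F\<^sub>o F\<^sub>a \<longleftrightarrow>
     (\<forall>j \<in> Obj J. F\<^sub>o j \<in> Obj C \<and> F\<^sub>a (Id J j) = Id C (F\<^sub>o j)) \<and>
     (\<forall>u \<in> Arr J. F\<^sub>a u \<in> Hom C (F\<^sub>o (Dom J u)) (F\<^sub>o (Cod J u))) \<and>
     (\<forall>u \<in> Arr J. \<forall>v \<in> Arr J. Dom J v = Cod J u \<longrightarrow>
        F\<^sub>a (v \<cdot>\<^bsub>J\<^esub> u) = F\<^sub>a v \<cdot>\<^bsub>C\<^esub> F\<^sub>a u)"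

definition is_cone ::
  "('p, 'b) category \<Rightarrow> ('o, 'a) category \<Rightarrow> ('p \<Rightarrow> 'o) \<Rightarrow> ('b \<Rightarrow> 'a) \<Rightarrow>
     'o \<Rightarrow> ('p \<Rightarrow> 'a) \<Rightarrow> bool" where
  "is_cone J C F\<^sub>o F\<^sub>a L \<pi> \<longleftrightarrow>
     L \<in> Obj C \<and> (\<forall>j \<in> Obj J. \<pi> j \<in> Hom C L (F\<^sub>o j)) \<and>
     (\<forall>u \<in> Arr J. F\<^sub>a u \<cdot>\<^bsub>C\<^esub> \<pi> (Dom J u) = \<pi> (Cod J u))"

definition is_limit ::
  "('p, 'b) category \<Rightarrow> ('o, 'a) category \<Rightarrow> ('p \<Rightarrow> 'o) \<Rightarrow> ('b \<Rightarrow> 'a) \<Rightarrow>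
     'o \<Rightarrow> ('p \<Rightarrow> 'a) \<Rightarrow> bool" where
  "is_limit J C F\<^sub>o F\<^sub>a L \<pi> \<longleftrightarrow>
     is_cone J C F\<^sub>o F\<^sub>a L \<pi> \<and>
     (\<forall>M \<mu>. is_cone J C F\<^sub>o F\<^sub>a M \<mu> \<longrightarrow>
        (\<exists>!h. h \<in> Hom C M L \<and> (\<forall>j \<in> Obj J. \<pi> j \<cdot>\<^bsub>C\<^esub> h = \<mu> j)))"

text \<open>Every finite category is isomorphic to one whose objects and arrows are natural numbers,
  so it suffices to let the index category range over these.\<close>

locale finitely_complete_category = category +
  assumes finite_limits:
    "category (J :: (nat, nat) category) \<Longrightarrow> finite (Obj J) \<Longrightarrow> finite (Arr J) \<Longrightarrow>
     is_functor J C F\<^sub>o F\<^sub>a \<Longrightarrow> \<exists>L \<pi>. is_limit J C F\<^sub>o F\<^sub>a L \<pi>"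

definition is_product ::
  "('o, 'a) category \<Rightarrow> 'o \<Rightarrow> 'o \<Rightarrow> 'o \<Rightarrow> 'a \<Rightarrow> 'a \<Rightarrow> bool" where
  "is_product C X Y P p q \<longleftrightarrow>
     p \<in> Hom C P X \<and> q \<in> Hom C P Y \<and>
     (\<forall>T. \<forall>f \<in> Hom C T X. \<forall>g \<in> Hom C T Y.
        \<exists>!h. h \<in> Hom C T P \<and> p \<cdot>\<^bsub>C\<^esub> h = f \<and> q \<cdot>\<^bsub>C\<^esub> h = g)"

text \<open>The arrow \<open>\<langle>f, g\<rangle>\<close> into the product with projections \<open>p\<close> and \<open>q\<close>.\<close>

definition pairing :: "('o, 'a) category \<Rightarrow> 'a \<Rightarrow> 'a \<Rightarrow> 'a \<Rightarrow> 'a \<Rightarrow> 'a" where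
  "pairing C p q f g =
     (THE h. h \<in> Hom C (Dom C f) (Dom C p) \<and> p \<cdot>\<^bsub>C\<^esub> h = f \<and> q \<cdot>\<^bsub>C\<^esub> h = g)"

text \<open>In \<open>is_pullback C f g p q\<close>, the arrow \<open>p\<close> goes to the domain of \<open>f\<close> and \<open>q\<close> to that of \<open>g\<close>.\<close>

definition is_pullback :: "('o, 'a) category \<Rightarrow> 'a \<Rightarrow> 'a \<Rightarrow> 'a \<Rightarrow> 'a \<Rightarrow> bool" where
  "is_pullback C f g p q \<longleftrightarrow>
     f \<in> Arr C \<and> g \<in> Arr C \<and> Cod C f = Cod C g \<and>
     p \<in> Hom C (Dom C p) (Dom C f) \<and> q \<in> Hom C (Dom C p) (Dom C g) \<and>
     f \<cdot>\<^bsub>C\<^esub> p = g \<cdot>\<^bsub>C\<^esub> q \<and>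
     (\<forall>T. \<forall>a \<in> Hom C T (Dom C f). \<forall>b \<in> Hom C T (Dom C g).
        f \<cdot>\<^bsub>C\<^esub> a = g \<cdot>\<^bsub>C\<^esub> b \<longrightarrow>
        (\<exists>!h. h \<in> Hom C T (Dom C p) \<and> p \<cdot>\<^bsub>C\<^esub> h = a \<and> q \<cdot>\<^bsub>C\<^esub> h = b))"

section \<open>Monomorphisms and subobjects\<close>

definition is_mono :: "('o, 'a) category \<Rightarrow> 'a \<Rightarrow> bool" where
  "is_mono C m \<longleftrightarrow> m \<in> Arr C \<and>
     (\<forall>T. \<forall>f \<in> Hom C T (Dom C m). \<forall>g \<in> Hom C T (Dom C m).
        m \<cdot>\<^bsub>C\<^esub> f = m \<cdot>\<^bsub>C\<^esub> g \<longrightarrow> f = g)"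

definition sub_le :: "('o, 'a) category \<Rightarrow> 'a \<Rightarrow> 'a \<Rightarrow> bool" where
  "sub_le C m n \<longleftrightarrow> (\<exists>h \<in> Hom C (Dom C m) (Dom C n). n \<cdot>\<^bsub>C\<^esub> h = m)"

text \<open>Subobjects of \<open>A\<close> are represented by monomorphisms into \<open>A\<close>, preordered by \<open>sub_le\<close>;
  \<open>j\<close> represents the join of those represented by \<open>k\<close> and \<open>l\<close>.\<close>

definition is_join :: "('o, 'a) category \<Rightarrow> 'o \<Rightarrow> 'a \<Rightarrow> 'a \<Rightarrow> 'a \<Rightarrow> bool" where
  "is_join C A k l j \<longleftrightarrow>
     is_mono C j \<and> Cod C j = A \<and> sub_le C k j \<and> sub_le C l j \<and>
     (\<forall>m. is_mono C m \<and> Cod C m = A \<and> sub_le C k m \<and> sub_le C l m \<longrightarrow> sub_le C j m)"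

section \<open>Internal relations and Mal'tsev categories\<close>

definition is_relation :: "('o, 'a) category \<Rightarrow> 'o \<Rightarrow> 'o \<Rightarrow> 'a \<Rightarrow> 'a \<Rightarrow> bool" where
  "is_relation C A R r\<^sub>1 r\<^sub>2 \<longleftrightarrow>
     r\<^sub>1 \<in> Hom C R A \<and> r\<^sub>2 \<in> Hom C R A \<and>
     (\<forall>T. \<forall>f \<in> Hom C T R. \<forall>g \<in> Hom C T R.
        r\<^sub>1 \<cdot>\<^bsub>C\<^esub> f = r\<^sub>1 \<cdot>\<^bsub>C\<^esub> g \<and> r\<^sub>2 \<cdot>\<^bsub>C\<^esub> f = r\<^sub>2 \<cdot>\<^bsub>C\<^esub> g \<longrightarrow> f = g)"

definition is_reflexive_relation ::
  "('o, 'a) category \<Rightarrow> 'o \<Rightarrow> 'o \<Rightarrow> 'a \<Rightarrow> 'a \<Rightarrow> bool" where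
  "is_reflexive_relation C A R r\<^sub>1 r\<^sub>2 \<longleftrightarrow>
     is_relation C A R r\<^sub>1 r\<^sub>2 \<and>
     (\<exists>e \<in> Hom C A R. r\<^sub>1 \<cdot>\<^bsub>C\<^esub> e = Id C A \<and> r\<^sub>2 \<cdot>\<^bsub>C\<^esub> e = Id C A)"

text \<open>In the transitivity clause, \<open>p\<^sub>1\<close> and \<open>p\<^sub>2\<close> are the projections of \<open>R \<times>\<^sub>A R\<close>, the object of
  pairs \<open>(a R b, b R c)\<close>.\<close>

definition is_equivalence_relation ::
  "('o, 'a) category \<Rightarrow> 'o \<Rightarrow> 'o \<Rightarrow> 'a \<Rightarrow> 'a \<Rightarrow> bool" where
  "is_equivalence_relation C A R r\<^sub>1 r\<^sub>2 \<longleftrightarrow>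
     is_reflexive_relation C A R r\<^sub>1 r\<^sub>2 \<and>
     (\<exists>s \<in> Hom C R R. r\<^sub>1 \<cdot>\<^bsub>C\<^esub> s = r\<^sub>2 \<and> r\<^sub>2 \<cdot>\<^bsub>C\<^esub> s = r\<^sub>1) \<and>
     (\<exists>p\<^sub>1 p\<^sub>2. is_pullback C r\<^sub>2 r\<^sub>1 p\<^sub>1 p\<^sub>2 \<and>
        (\<exists>t \<in> Hom C (Dom C p\<^sub>1) R.
           r\<^sub>1 \<cdot>\<^bsub>C\<^esub> t = r\<^sub>1 \<cdot>\<^bsub>C\<^esub> p\<^sub>1 \<and> r\<^sub>2 \<cdot>\<^bsub>C\<^esub> t = r\<^sub>2 \<cdot>\<^bsub>C\<^esub> p\<^sub>2))"

locale maltsev_category = finitely_complete_category +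
  assumes reflexive_imp_equivalence:
    "is_reflexive_relation C A R r\<^sub>1 r\<^sub>2 \<Longrightarrow> is_equivalence_relation C A R r\<^sub>1 r\<^sub>2"

section \<open>Pointed categories\<close>

definition is_zero_object :: "('o, 'a) category \<Rightarrow> 'o \<Rightarrow> bool" where
  "is_zero_object C Z \<longleftrightarrow> Z \<in> Obj C \<and>
     (\<forall>X \<in> Obj C. (\<exists>!f. f \<in> Hom C X Z) \<and> (\<exists>!f. f \<in> Hom C Z X))"

locale pointed_category = category +
  assumes zero_object_exists: "\<exists>Z. is_zero_object C Z"

locale pointed_maltsev_category = pointed_category + maltsev_category

definition zero_arr :: "('o, 'a) category \<Rightarrow> 'o \<Rightarrow> 'o \<Rightarrow> 'a" where
  "zero_arr C X Y =
     (THE f. \<exists>Z g h. is_zero_object C Z \<and> g \<in> Hom C X Z \<and> h \<in> Hom C Z Y \<and> f = h \<cdot>\<^bsub>C\<^esub> g)"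

definition is_kernel :: "('o, 'a) category \<Rightarrow> 'a \<Rightarrow> 'a \<Rightarrow> bool" where
  "is_kernel C f k \<longleftrightarrow>
     f \<in> Arr C \<and> k \<in> Hom C (Dom C k) (Dom C f) \<and>
     f \<cdot>\<^bsub>C\<^esub> k = zero_arr C (Dom C k) (Cod C f) \<and>
     (\<forall>T. \<forall>g \<in> Hom C T (Dom C f). f \<cdot>\<^bsub>C\<^esub> g = zero_arr C T (Cod C f) \<longrightarrow>
        (\<exists>!h. h \<in> Hom C T (Dom C k) \<and> k \<cdot>\<^bsub>C\<^esub> h = g))"

definition has_zero_kernel :: "('o, 'a) category \<Rightarrow> 'a \<Rightarrow> bool" where
  "has_zero_kernel C f \<longleftrightarrow> (\<exists>k. is_kernel C f k \<and> is_zero_object C (Dom C k))"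

definition has_trivial_pullback :: "('o, 'a) category \<Rightarrow> 'a \<Rightarrow> 'a \<Rightarrow> bool" where
  "has_trivial_pullback C k l \<longleftrightarrow> (\<exists>p q. is_pullback C k l p q \<and> is_zero_object C (Dom C p))"

text \<open>\<open>\<phi>\<close> is a cooperator of \<open>f\<close> and \<open>g\<close>, relative to a product \<open>P\<close> of their domains with
  projections \<open>p\<close> and \<open>q\<close>.\<close>

definition is_cooperator ::
  "('o, 'a) category \<Rightarrow> 'o \<Rightarrow> 'a \<Rightarrow> 'a \<Rightarrow> 'a \<Rightarrow> 'a \<Rightarrow> 'a \<Rightarrow> bool" where
  "is_cooperator C P p q f g \<phi> \<longleftrightarrow>
     (let X = Dom C f; Y = Dom C g in
      f \<in> Arr C \<and> g \<in> Hom C Y (Cod C f) \<and>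
      is_product C X Y P p q \<and> \<phi> \<in> Hom C P (Cod C f) \<and>
      \<phi> \<cdot>\<^bsub>C\<^esub> pairing C p q (Id C X) (zero_arr C X Y) = f \<and>
      \<phi> \<cdot>\<^bsub>C\<^esub> pairing C p q (zero_arr C Y X) (Id C Y) = g)"

definition huq_commute :: "('o, 'a) category \<Rightarrow> 'a \<Rightarrow> 'a \<Rightarrow> bool" where
  "huq_commute C f g \<longleftrightarrow> (\<exists>P p q \<phi>. is_cooperator C P p q f g \<phi>)"

text \<open>Here \<open>P\<close> is \<open>A \<times> A\<close> with projections \<open>p\<close> and \<open>q\<close>.\<close>

definition is_bourn_normal_mono :: "('o, 'a) category \<Rightarrow> 'a \<Rightarrow> bool" where
  "is_bourn_normal_mono C k \<longleftrightarrow> is_mono C k \<and>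
     (let A = Cod C k in
      \<exists>P p q R r\<^sub>1 r\<^sub>2 \<kappa>.
        is_product C A A P p q \<and> is_equivalence_relation C A R r\<^sub>1 r\<^sub>2 \<and>
        is_pullback C (pairing C p q r\<^sub>1 r\<^sub>2) (pairing C p q (Id C A) (zero_arr C A A)) \<kappa> k)"

end

theory Submission
  imports Defs
begin

text \<open>Let \<open>R\<close> and \<open>S\<close> be the equivalence relations with zero classes \<open>k\<close> and \<open>l\<close>. As the zero
  classes meet trivially, the hypothesis on kernels makes \<open>R \<inter> S\<close> discrete. Hence, for \<open>x\<close> in
  \<open>X\<close> and \<open>y\<close> in \<open>Y\<close>, there is at most one \<open>\<phi>(x, y)\<close> with \<open>l y R \<phi>(x, y)\<close> and
  \<open>k x S \<phi>(x, y)\<close>; one exists on both axes of \<open>X \<times> Y\<close>, so everywhere, since a relation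
  containing both axes is everything. Discreteness also makes \<open>R\<close> and \<open>S\<close> compose to a relation; it
  is reflexive, hence an equivalence, and its zero class is \<open>\<phi>\<close>. Throughout, elements are
  generalized elements, that is, arrows with arbitrary domain.\<close>

section \<open>Generalized elements and relations\<close>

context category
begin

text \<open>The category is not assumed regular, so there are no images: a statement "there is
  \<open>e\<close> with ..." about generalized elements need not cut out a subobject. Finite limits
  only yield the object that carries the witness along, and this is a subobject as soon as the
  witness is unique. Discreteness of the intersection of \<open>R\<close> and \<open>S\<close>
  supplies that uniqueness, once for the domain on which \<open>\<phi>\<close> is defined and once
  for the composite of \<open>R\<close> and \<open>S\<close>. The kernel hypothesis enters twice:
  for this intersection, and for \<open>\<phi>\<close> itself, whose kernel is computed from the
  trivial pullback. Bourn-normality is translated at the start into "\<open>a\<close> is related to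
  0 iff \<open>a\<close> factors through \<open>k\<close>", so that the product of \<open>A\<close>
  with itself and the pairings disappear until the end.\<close>

lemma Hom_iff: "f \<in> Hom C A B \<longleftrightarrow> f \<in> Arr C \<and> Dom C f = A \<and> Cod C f = B"
  by (auto simp: Hom_def)

lemma Hom_objs: "f \<in> Hom C A B \<Longrightarrow> A \<in> Obj C \<and> B \<in> Obj C"
  using Dom_in_Obj Cod_in_Obj by (auto simp: Hom_def)

text \<open>This evaluates a commuting square at a generalized element; nearly every computation
  with limits below has this form.\<close>

lemma Comp_eq_Comp:
  assumes "f \<cdot> p = g \<cdot> q" "p \<in> Hom C L B" "f \<in> Hom C B E" "q \<in> Hom C L D" "g \<in> Hom C D E"
    "h \<in> Hom C T L"
  shows "f \<cdot> (p \<cdot> h) = g \<cdot> (q \<cdot> h)"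
  using assms(1) Comp_assoc[OF assms(6,2,3)] Comp_assoc[OF assms(6,4,5)] by simp

text \<open>This is membership of the pair in the relation, expressed as a factorization through its
  two legs, so that no product has to be chosen. The domain of the elements is read off from
  \<open>a\<close> and the carrier of the relation from \<open>r\<^sub>1\<close>.\<close>

definition related :: "'a \<Rightarrow> 'a \<Rightarrow> 'a \<Rightarrow> 'a \<Rightarrow> bool" where
  "related r\<^sub>1 r\<^sub>2 a b \<longleftrightarrow>
     (\<exists>h \<in> Hom C (Dom C a) (Dom C r\<^sub>1). r\<^sub>1 \<cdot> h = a \<and> r\<^sub>2 \<cdot> h = b)"

lemma relatedI:
  assumes "h \<in> Hom C T R" "r\<^sub>1 \<in> Hom C R A" "r\<^sub>1 \<cdot> h = a" "r\<^sub>2 \<cdot> h = b"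
  shows "related r\<^sub>1 r\<^sub>2 a b"
proof -
  have "a \<in> Hom C T A" using Comp_in_Hom assms by metis
  then show ?thesis using assms by (auto simp: related_def Hom_iff)
qed

lemma relatedE:
  assumes "related r\<^sub>1 r\<^sub>2 a b" "a \<in> Hom C T A" "r\<^sub>1 \<in> Hom C R A"
  obtains h where "h \<in> Hom C T R" "r\<^sub>1 \<cdot> h = a" "r\<^sub>2 \<cdot> h = b"
  using assms by (auto simp: related_def Hom_iff)

lemma related_in_Hom:
  assumes "related r\<^sub>1 r\<^sub>2 a b" "is_relation C A R r\<^sub>1 r\<^sub>2" "a \<in> Hom C T A"
  shows "b \<in> Hom C T A"
proof -
  have r: "r\<^sub>1 \<in> Hom C R A" "r\<^sub>2 \<in> Hom C R A" using assms(2) by (auto simp: is_relation_def)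
  obtain h where "h \<in> Hom C T R" "r\<^sub>2 \<cdot> h = b" using relatedE[OF assms(1,3) r(1)] .
  then show ?thesis using Comp_in_Hom[OF _ r(2)] by auto
qed

lemma related_Comp:
  assumes "related r\<^sub>1 r\<^sub>2 a b" "is_relation C A R r\<^sub>1 r\<^sub>2" "a \<in> Hom C T A" "t \<in> Hom C U T"
  shows "related r\<^sub>1 r\<^sub>2 (a \<cdot> t) (b \<cdot> t)"
proof -
  have r: "r\<^sub>1 \<in> Hom C R A" "r\<^sub>2 \<in> Hom C R A" using assms(2) by (auto simp: is_relation_def)
  obtain h where h: "h \<in> Hom C T R" "r\<^sub>1 \<cdot> h = a" "r\<^sub>2 \<cdot> h = b"
    using relatedE[OF assms(1,3) r(1)] .
  show ?thesis
    using relatedI[OF Comp_in_Hom[OF assms(4) h(1)] r(1)] Comp_assoc[OF assms(4) h(1) r(1)]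
      Comp_assoc[OF assms(4) h(1) r(2)] h by simp
qed

lemma equivalence_relation:
  assumes "is_equivalence_relation C A R r\<^sub>1 r\<^sub>2"
  shows "is_relation C A R r\<^sub>1 r\<^sub>2"
  using assms by (simp add: is_equivalence_relation_def is_reflexive_relation_def)

lemma related_refl:
  assumes "is_equivalence_relation C A R r\<^sub>1 r\<^sub>2" "a \<in> Hom C T A"
  shows "related r\<^sub>1 r\<^sub>2 a a"
proof -
  obtain e where e: "e \<in> Hom C A R" "r\<^sub>1 \<cdot> e = Id C A" "r\<^sub>2 \<cdot> e = Id C A"
    and r: "r\<^sub>1 \<in> Hom C R A" "r\<^sub>2 \<in> Hom C R A"
    using assms(1)
    by (auto simp: is_equivalence_relation_def is_reflexive_relation_def is_relation_def)
  show ?thesis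
    using relatedI[OF Comp_in_Hom[OF assms(2) e(1)] r(1)] Comp_assoc[OF assms(2) e(1) r(1)]
      Comp_assoc[OF assms(2) e(1) r(2)] e Id_Comp[OF assms(2)] by simp
qed

lemma related_sym:
  assumes "is_equivalence_relation C A R r\<^sub>1 r\<^sub>2" "a \<in> Hom C T A" "related r\<^sub>1 r\<^sub>2 a b"
  shows "related r\<^sub>1 r\<^sub>2 b a"
proof -
  obtain s where s: "s \<in> Hom C R R" "r\<^sub>1 \<cdot> s = r\<^sub>2" "r\<^sub>2 \<cdot> s = r\<^sub>1"
    and r: "r\<^sub>1 \<in> Hom C R A" "r\<^sub>2 \<in> Hom C R A"
    using assms(1)
    by (auto simp: is_equivalence_relation_def is_reflexive_relation_def is_relation_def)
  obtain h where h: "h \<in> Hom C T R" "r\<^sub>1 \<cdot> h = a" "r\<^sub>2 \<cdot> h = b"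
    using relatedE[OF assms(3,2) r(1)] .
  show ?thesis
    using relatedI[OF Comp_in_Hom[OF h(1) s(1)] r(1)] Comp_assoc[OF h(1) s(1) r(1)]
      Comp_assoc[OF h(1) s(1) r(2)] s h by simp
qed

lemma related_trans:
  assumes E: "is_equivalence_relation C A R r\<^sub>1 r\<^sub>2" and a: "a \<in> Hom C T A"
    and ab: "related r\<^sub>1 r\<^sub>2 a b" and bc: "related r\<^sub>1 r\<^sub>2 b c"
  shows "related r\<^sub>1 r\<^sub>2 a c"
proof -
  have r: "r\<^sub>1 \<in> Hom C R A" "r\<^sub>2 \<in> Hom C R A"
    using equivalence_relation[OF E] by (auto simp: is_relation_def)
  obtain p\<^sub>1 p\<^sub>2 t where pb: "is_pullback C r\<^sub>2 r\<^sub>1 p\<^sub>1 p\<^sub>2" and t: "t \<in> Hom C (Dom C p\<^sub>1) R"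
    "r\<^sub>1 \<cdot> t = r\<^sub>1 \<cdot> p\<^sub>1" "r\<^sub>2 \<cdot> t = r\<^sub>2 \<cdot> p\<^sub>2"
    using E by (auto simp: is_equivalence_relation_def)
  have b: "b \<in> Hom C T A" using related_in_Hom[OF ab equivalence_relation[OF E] a] .
  obtain h where h: "h \<in> Hom C T R" "r\<^sub>1 \<cdot> h = a" "r\<^sub>2 \<cdot> h = b" using relatedE[OF ab a r(1)] .
  obtain g where g: "g \<in> Hom C T R" "r\<^sub>1 \<cdot> g = b" "r\<^sub>2 \<cdot> g = c" using relatedE[OF bc b r(1)] .
  have D: "Dom C r\<^sub>1 = R" "Dom C r\<^sub>2 = R" using r by (auto simp: Hom_iff)
  have p: "p\<^sub>1 \<in> Hom C (Dom C p\<^sub>1) R" "p\<^sub>2 \<in> Hom C (Dom C p\<^sub>1) R"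
    using pb D by (auto simp: is_pullback_def)
  obtain m where m: "m \<in> Hom C T (Dom C p\<^sub>1)" "p\<^sub>1 \<cdot> m = h" "p\<^sub>2 \<cdot> m = g"
    using pb h g unfolding is_pullback_def D by metis
  have "r\<^sub>1 \<cdot> (t \<cdot> m) = a" "r\<^sub>2 \<cdot> (t \<cdot> m) = c"
    using Comp_eq_Comp[OF t(2) t(1) r(1) p(1) r(1) m(1)]
      Comp_eq_Comp[OF t(3) t(1) r(2) p(2) r(2) m(1)] m h g by auto
  then show ?thesis using relatedI[OF Comp_in_Hom[OF m(1) t(1)] r(1)] by simp
qed

section \<open>Extensionality for products, relations and monomorphisms\<close>

lemma pairing:
  assumes "is_product C X Y P p q" "f \<in> Hom C T X" "g \<in> Hom C T Y"
  shows "pairing C p q f g \<in> Hom C T P" "p \<cdot> pairing C p q f g = f" "q \<cdot> pairing C p q f g = g"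
proof -
  have D: "Dom C f = T" "Dom C p = P" using assms by (auto simp: is_product_def Hom_iff)
  have "\<exists>!h. h \<in> Hom C T P \<and> p \<cdot> h = f \<and> q \<cdot> h = g"
    using assms by (auto simp: is_product_def)
  from theI'[OF this]
  show "pairing C p q f g \<in> Hom C T P" "p \<cdot> pairing C p q f g = f" "q \<cdot> pairing C p q f g = g"
    unfolding pairing_def D by auto
qed

lemma product_ext:
  assumes "is_product C X Y P p q" "f \<in> Hom C T P" "g \<in> Hom C T P"
    "p \<cdot> f = p \<cdot> g" "q \<cdot> f = q \<cdot> g"
  shows "f = g"
proof -
  have "p \<cdot> g \<in> Hom C T X" "q \<cdot> g \<in> Hom C T Y"
    using assms Comp_in_Hom unfolding is_product_def by metis+
  then show ?thesis using assms unfolding is_product_def by metis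
qed

lemma relation_ext:
  assumes "is_relation C A R r\<^sub>1 r\<^sub>2" "f \<in> Hom C T R" "g \<in> Hom C T R"
    "r\<^sub>1 \<cdot> f = r\<^sub>1 \<cdot> g" "r\<^sub>2 \<cdot> f = r\<^sub>2 \<cdot> g"
  shows "f = g"
  using assms by (auto simp: is_relation_def)

lemma is_monoI:
  assumes "m \<in> Hom C B A"
    "\<And>T f g. f \<in> Hom C T B \<Longrightarrow> g \<in> Hom C T B \<Longrightarrow> m \<cdot> f = m \<cdot> g \<Longrightarrow> f = g"
  shows "is_mono C m"
  using assms by (auto simp: is_mono_def Hom_iff)

lemma is_monoD:
  assumes "is_mono C m" "m \<in> Hom C B A" "f \<in> Hom C T B" "g \<in> Hom C T B" "m \<cdot> f = m \<cdot> g"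
  shows "f = g"
  using assms by (auto simp: is_mono_def Hom_iff)

end

section \<open>Limits\<close>

context finitely_complete_category
begin

text \<open>Two cospans sharing their sources make one diagram that covers every limit needed:
  pullbacks, equalizers, and subobjects cut out by two conditions at once. It is built directly
  because products are obtained only later, from pullbacks.\<close>

lemma double_pullback_exists:
  assumes f: "f\<^sub>1 \<in> Hom C B E\<^sub>1" "f\<^sub>2 \<in> Hom C B E\<^sub>2" and g: "g\<^sub>1 \<in> Hom C D E\<^sub>1" "g\<^sub>2 \<in> Hom C D E\<^sub>2"
  obtains L p q where "p \<in> Hom C L B" "q \<in> Hom C L D" "f\<^sub>1 \<cdot> p = g\<^sub>1 \<cdot> q" "f\<^sub>2 \<cdot> p = g\<^sub>2 \<cdot> q"
    "\<And>T a b. a \<in> Hom C T B \<Longrightarrow> b \<in> Hom C T D \<Longrightarrow> f\<^sub>1 \<cdot> a = g\<^sub>1 \<cdot> b \<Longrightarrow> f\<^sub>2 \<cdot> a = g\<^sub>2 \<cdot> b \<Longrightarrow>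
       \<exists>h \<in> Hom C T L. p \<cdot> h = a \<and> q \<cdot> h = b"
    "\<And>T h h'. h \<in> Hom C T L \<Longrightarrow> h' \<in> Hom C T L \<Longrightarrow> p \<cdot> h = p \<cdot> h' \<Longrightarrow> q \<cdot> h = q \<cdot> h' \<Longrightarrow> h = h'"
proof -
  \<comment> \<open>The index category has objects \<open>0, 1, 2, 3\<close> (for \<open>B, D, E\<^sub>1, E\<^sub>2\<close>), which also serve as
    their identities, and arrows \<open>4, 5, 6, 7\<close> (for \<open>f\<^sub>1, g\<^sub>1, f\<^sub>2, g\<^sub>2\<close>).\<close>
  define J :: "(nat, nat) category" where
    "J = \<lparr>Obj = {0, 1, 2, 3}, Arr = {0, 1, 2, 3, 4, 5, 6, 7},
      Dom = (\<lambda>u. if u < 4 then u else if u = 4 \<or> u = 6 then 0 else 1),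
      Cod = (\<lambda>u. if u < 4 then u else if u = 4 \<or> u = 5 then 2 else 3),
      Id = (\<lambda>j. j), Comp = (\<lambda>v u. if u < 4 then v else u)\<rparr>"
  define F :: "nat \<Rightarrow> 'a" where
    "F j = (if j = 0 then B else if j = 1 then D else if j = 2 then E\<^sub>1 else E\<^sub>2)" for j
  define G :: "nat \<Rightarrow> 'b" where
    "G u = (if u < 4 then Id C (F u) else if u = 4 then f\<^sub>1 else if u = 5 then g\<^sub>1
       else if u = 6 then f\<^sub>2 else g\<^sub>2)" for u
  have obj: "B \<in> Obj C" "D \<in> Obj C" "E\<^sub>1 \<in> Obj C" "E\<^sub>2 \<in> Obj C"
    using f g Hom_objs by auto
  \<comment> \<open>No two non-identity arrows of \<open>J\<close> are composable, so the
    conditional defining \<open>Comp\<close> gives the right value on every composable pair, and the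
    axioms reduce to case distinctions.\<close>
  have J: "category J"
  proof -
    have arr: "u \<in> Arr J \<longleftrightarrow> u < 8" and obj: "u \<in> Obj J \<longleftrightarrow> u < 4" for u
      by (auto simp: J_def)
    have J_simps: "Dom J u = (if u < 4 then u else if u = 4 \<or> u = 6 then 0 else 1)"
      "Cod J u = (if u < 4 then u else if u = 4 \<or> u = 5 then 2 else 3)"
      "Id J u = u" "v \<cdot>\<^bsub>J\<^esub> u = (if u < 4 then v else u)" for u v
      by (simp_all add: J_def)
    show ?thesis
      by unfold_locales (simp_all add: Hom_def arr obj J_simps split: if_splits)
  qed
  have fin: "finite (Obj J)" "finite (Arr J)" by (auto simp: J_def)
  have fct: "is_functor J C F G"
    unfolding is_functor_def J_def F_def G_def
    using f g obj Id_in_Hom Id_Comp[OF Id_in_Hom] Id_Comp[OF f(1)] Id_Comp[OF f(2)]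
      Id_Comp[OF g(1)] Id_Comp[OF g(2)] Comp_Id[OF f(1)] Comp_Id[OF f(2)] Comp_Id[OF g(1)]
      Comp_Id[OF g(2)] by auto
  \<comment> \<open>The legs at 2 and 3 are forced by those at 0 and 1, so a cone amounts to two
    arrows satisfying two equations.\<close>
  have cone: "is_cone J C F G L \<pi> \<longleftrightarrow> L \<in> Obj C \<and> \<pi> 0 \<in> Hom C L B \<and> \<pi> 1 \<in> Hom C L D \<and>
      \<pi> 2 = f\<^sub>1 \<cdot> \<pi> 0 \<and> \<pi> 2 = g\<^sub>1 \<cdot> \<pi> 1 \<and> \<pi> 3 = f\<^sub>2 \<cdot> \<pi> 0 \<and> \<pi> 3 = g\<^sub>2 \<cdot> \<pi> 1" for L \<pi>
    unfolding is_cone_def J_def F_def G_def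
    using f g Comp_in_Hom[of "\<pi> 0" L B] Id_Comp[of "\<pi> 0" L B] Id_Comp[of "\<pi> 1" L D]
      Id_Comp[of "f\<^sub>1 \<cdot> \<pi> 0" L E\<^sub>1] Id_Comp[of "f\<^sub>2 \<cdot> \<pi> 0" L E\<^sub>2] by auto
  obtain L \<pi> where lim: "is_limit J C F G L \<pi>"
    using finite_limits[OF J fin fct] by auto
  then have \<pi>: "\<pi> 0 \<in> Hom C L B" "\<pi> 1 \<in> Hom C L D" "\<pi> 2 = f\<^sub>1 \<cdot> \<pi> 0" "\<pi> 2 = g\<^sub>1 \<cdot> \<pi> 1"
    "\<pi> 3 = f\<^sub>2 \<cdot> \<pi> 0" "\<pi> 3 = g\<^sub>2 \<cdot> \<pi> 1"
    unfolding is_limit_def cone by auto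
  have univ: "\<exists>!h. h \<in> Hom C T L \<and> \<pi> 0 \<cdot> h = a \<and> \<pi> 1 \<cdot> h = b"
    if ab: "a \<in> Hom C T B" "b \<in> Hom C T D" "f\<^sub>1 \<cdot> a = g\<^sub>1 \<cdot> b" "f\<^sub>2 \<cdot> a = g\<^sub>2 \<cdot> b" for T a b
  proof -
    define \<mu> where "\<mu> j = (if j = 0 then a else if j = 1 then b else if j = 2 then f\<^sub>1 \<cdot> a
      else f\<^sub>2 \<cdot> a)" for j :: nat
    have "is_cone J C F G T \<mu>"
      unfolding cone \<mu>_def using ab Hom_objs by auto
    then have "\<exists>!h. h \<in> Hom C T L \<and> (\<forall>j \<in> Obj J. \<pi> j \<cdot> h = \<mu> j)"
      using lim unfolding is_limit_def by blast
    moreover have "(\<forall>j \<in> Obj J. \<pi> j \<cdot> h = \<mu> j) \<longleftrightarrow> \<pi> 0 \<cdot> h = a \<and> \<pi> 1 \<cdot> h = b"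
      if "h \<in> Hom C T L" for h
    proof -
      have "\<pi> 2 \<cdot> h = f\<^sub>1 \<cdot> (\<pi> 0 \<cdot> h)" "\<pi> 3 \<cdot> h = f\<^sub>2 \<cdot> (\<pi> 0 \<cdot> h)"
        unfolding \<pi>(3) \<pi>(5) using Comp_assoc that \<pi>(1) f by auto
      then show ?thesis unfolding J_def \<mu>_def by auto
    qed
    ultimately show ?thesis by (metis (no_types, lifting))
  qed
  show thesis
  proof (rule that[of "\<pi> 0" L "\<pi> 1"])
    fix T h h' assume h: "h \<in> Hom C T L" "h' \<in> Hom C T L" "\<pi> 0 \<cdot> h = \<pi> 0 \<cdot> h'" "\<pi> 1 \<cdot> h = \<pi> 1 \<cdot> h'"
    have eqs: "f\<^sub>1 \<cdot> \<pi> 0 = g\<^sub>1 \<cdot> \<pi> 1" "f\<^sub>2 \<cdot> \<pi> 0 = g\<^sub>2 \<cdot> \<pi> 1" using \<pi> by auto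
    have "f\<^sub>1 \<cdot> (\<pi> 0 \<cdot> h) = g\<^sub>1 \<cdot> (\<pi> 1 \<cdot> h)" "f\<^sub>2 \<cdot> (\<pi> 0 \<cdot> h) = g\<^sub>2 \<cdot> (\<pi> 1 \<cdot> h)"
      using Comp_eq_Comp[OF eqs(1) \<pi>(1) f(1) \<pi>(2) g(1) h(1)]
        Comp_eq_Comp[OF eqs(2) \<pi>(1) f(2) \<pi>(2) g(2) h(1)] by auto
    then have "\<exists>!m. m \<in> Hom C T L \<and> \<pi> 0 \<cdot> m = \<pi> 0 \<cdot> h \<and> \<pi> 1 \<cdot> m = \<pi> 1 \<cdot> h"
      by (rule univ[OF Comp_in_Hom[OF h(1) \<pi>(1)] Comp_in_Hom[OF h(1) \<pi>(2)]])
    then show "h = h'" using h by auto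
  next
    fix T a b
    assume "a \<in> Hom C T B" "b \<in> Hom C T D" "f\<^sub>1 \<cdot> a = g\<^sub>1 \<cdot> b" "f\<^sub>2 \<cdot> a = g\<^sub>2 \<cdot> b"
    from univ[OF this] show "\<exists>h \<in> Hom C T L. \<pi> 0 \<cdot> h = a \<and> \<pi> 1 \<cdot> h = b" by blast
  qed (use \<pi> in auto)
qed

text \<open>With the same cospan taken twice, the second equation repeats the first.\<close>

lemma pullback_exists:
  assumes f: "f \<in> Hom C B E" and g: "g \<in> Hom C D E"
  obtains L p q where "p \<in> Hom C L B" "q \<in> Hom C L D" "f \<cdot> p = g \<cdot> q"
    "\<And>T a b. a \<in> Hom C T B \<Longrightarrow> b \<in> Hom C T D \<Longrightarrow> f \<cdot> a = g \<cdot> b \<Longrightarrow>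
       \<exists>h \<in> Hom C T L. p \<cdot> h = a \<and> q \<cdot> h = b"
    "\<And>T h h'. h \<in> Hom C T L \<Longrightarrow> h' \<in> Hom C T L \<Longrightarrow> p \<cdot> h = p \<cdot> h' \<Longrightarrow> q \<cdot> h = q \<cdot> h' \<Longrightarrow> h = h'"
proof (rule double_pullback_exists[OF f f g g])
  fix L p q
  assume pq: "p \<in> Hom C L B" "q \<in> Hom C L D" "f \<cdot> p = g \<cdot> q"
    and ex: "\<And>T a b. a \<in> Hom C T B \<Longrightarrow> b \<in> Hom C T D \<Longrightarrow> f \<cdot> a = g \<cdot> b \<Longrightarrow> f \<cdot> a = g \<cdot> b \<Longrightarrow>
       \<exists>h \<in> Hom C T L. p \<cdot> h = a \<and> q \<cdot> h = b"
    and ext: "\<And>T h h'. h \<in> Hom C T L \<Longrightarrow> h' \<in> Hom C T L \<Longrightarrow> p \<cdot> h = p \<cdot> h' \<Longrightarrow>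
      q \<cdot> h = q \<cdot> h' \<Longrightarrow> h = h'"
  have "\<exists>h \<in> Hom C T L. p \<cdot> h = a \<and> q \<cdot> h = b"
    if "a \<in> Hom C T B" "b \<in> Hom C T D" "f \<cdot> a = g \<cdot> b" for T a b
    by (rule ex[OF that that(3)])
  then show thesis by (rule that[OF pq _ ext])
qed

text \<open>\<open>W\<close> is the object of pairs \<open>(z, e)\<close> with
  \<open>f z R e\<close> and \<open>g z S e\<close>. With both \<open>f\<close> and \<open>g\<close>
  the identity it is the intersection of \<open>R\<close> and \<open>S\<close>; with
  \<open>l q\<close> and \<open>k p\<close> it is the graph of \<open>\<phi>\<close>; with the two
  projections of a product it is the composite of \<open>R\<close> and \<open>S\<close> with its
  intermediate element.\<close>

lemma comprehension_exists:
  assumes R: "is_relation C A R r\<^sub>1 r\<^sub>2" and S: "is_relation C A S s\<^sub>1 s\<^sub>2"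
    and f: "f \<in> Hom C Q A" and g: "g \<in> Hom C Q A"
  obtains W w d where "w \<in> Hom C W Q" "d \<in> Hom C W A"
    "related r\<^sub>1 r\<^sub>2 (f \<cdot> w) d" "related s\<^sub>1 s\<^sub>2 (g \<cdot> w) d"
    "\<And>T z e. z \<in> Hom C T Q \<Longrightarrow> related r\<^sub>1 r\<^sub>2 (f \<cdot> z) e \<Longrightarrow> related s\<^sub>1 s\<^sub>2 (g \<cdot> z) e \<Longrightarrow>
       \<exists>h \<in> Hom C T W. w \<cdot> h = z \<and> d \<cdot> h = e"
    "\<And>T h h'. h \<in> Hom C T W \<Longrightarrow> h' \<in> Hom C T W \<Longrightarrow> w \<cdot> h = w \<cdot> h' \<Longrightarrow> d \<cdot> h = d \<cdot> h' \<Longrightarrow> h = h'"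
proof -
  have r: "r\<^sub>1 \<in> Hom C R A" "r\<^sub>2 \<in> Hom C R A" using R by (auto simp: is_relation_def)
  have s: "s\<^sub>1 \<in> Hom C S A" "s\<^sub>2 \<in> Hom C S A" using S by (auto simp: is_relation_def)
  \<comment> \<open>\<open>V\<close> holds an element of \<open>R\<close> and an element of
    \<open>S\<close> with a common second end \<open>e\<close>; \<open>W\<close> then matches their
    first ends with \<open>f z\<close> and \<open>g z\<close>.\<close>
  obtain V u v where u: "u \<in> Hom C V R" and v: "v \<in> Hom C V S" and uv: "r\<^sub>2 \<cdot> u = s\<^sub>2 \<cdot> v"
    and V: "\<And>T a b. a \<in> Hom C T R \<Longrightarrow> b \<in> Hom C T S \<Longrightarrow> r\<^sub>2 \<cdot> a = s\<^sub>2 \<cdot> b \<Longrightarrow>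
       \<exists>h \<in> Hom C T V. u \<cdot> h = a \<and> v \<cdot> h = b"
    and V_ext: "\<And>T h h'. h \<in> Hom C T V \<Longrightarrow> h' \<in> Hom C T V \<Longrightarrow> u \<cdot> h = u \<cdot> h' \<Longrightarrow> v \<cdot> h = v \<cdot> h' \<Longrightarrow>
      h = h'"
    using pullback_exists[OF r(2) s(2)] by metis
  have ru: "r\<^sub>1 \<cdot> u \<in> Hom C V A" and sv: "s\<^sub>1 \<cdot> v \<in> Hom C V A"
    using Comp_in_Hom[OF u r(1)] Comp_in_Hom[OF v s(1)] .
  obtain W b w where b: "b \<in> Hom C W V" and w: "w \<in> Hom C W Q"
    and bw: "(r\<^sub>1 \<cdot> u) \<cdot> b = f \<cdot> w" "(s\<^sub>1 \<cdot> v) \<cdot> b = g \<cdot> w"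
    and W: "\<And>T x y. x \<in> Hom C T V \<Longrightarrow> y \<in> Hom C T Q \<Longrightarrow> (r\<^sub>1 \<cdot> u) \<cdot> x = f \<cdot> y \<Longrightarrow>
      (s\<^sub>1 \<cdot> v) \<cdot> x = g \<cdot> y \<Longrightarrow> \<exists>h \<in> Hom C T W. b \<cdot> h = x \<and> w \<cdot> h = y"
    and W_ext: "\<And>T h h'. h \<in> Hom C T W \<Longrightarrow> h' \<in> Hom C T W \<Longrightarrow> b \<cdot> h = b \<cdot> h' \<Longrightarrow> w \<cdot> h = w \<cdot> h' \<Longrightarrow>
      h = h'"
    by (rule double_pullback_exists[OF ru sv f g], rule that)
  have ub: "u \<cdot> b \<in> Hom C W R" and vb: "v \<cdot> b \<in> Hom C W S" using Comp_in_Hom[OF b u] Comp_in_Hom[OF b v] .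
  define d where "d = r\<^sub>2 \<cdot> (u \<cdot> b)"
  have d: "d \<in> Hom C W A" unfolding d_def using Comp_in_Hom[OF ub r(2)] .
  have d': "d = s\<^sub>2 \<cdot> (v \<cdot> b)" unfolding d_def using Comp_eq_Comp[OF uv u r(2) v s(2) b] .
  have bw': "r\<^sub>1 \<cdot> (u \<cdot> b) = f \<cdot> w" "s\<^sub>1 \<cdot> (v \<cdot> b) = g \<cdot> w"
    using bw Comp_assoc[OF b u r(1)] Comp_assoc[OF b v s(1)] by auto
  show thesis
  proof (rule that[OF w d])
    show "related r\<^sub>1 r\<^sub>2 (f \<cdot> w) d" using relatedI[OF ub r(1) bw'(1)] d_def by auto
    show "related s\<^sub>1 s\<^sub>2 (g \<cdot> w) d" using relatedI[OF vb s(1) bw'(2)] d' by auto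
  next
    fix T z e
    assume z: "z \<in> Hom C T Q" and re: "related r\<^sub>1 r\<^sub>2 (f \<cdot> z) e" and se: "related s\<^sub>1 s\<^sub>2 (g \<cdot> z) e"
    obtain i where i: "i \<in> Hom C T R" "r\<^sub>1 \<cdot> i = f \<cdot> z" "r\<^sub>2 \<cdot> i = e"
      using relatedE[OF re Comp_in_Hom[OF z f] r(1)] .
    obtain j where j: "j \<in> Hom C T S" "s\<^sub>1 \<cdot> j = g \<cdot> z" "s\<^sub>2 \<cdot> j = e"
      using relatedE[OF se Comp_in_Hom[OF z g] s(1)] .
    obtain x where x: "x \<in> Hom C T V" "u \<cdot> x = i" "v \<cdot> x = j" using V[OF i(1) j(1)] i j by auto
    have "(r\<^sub>1 \<cdot> u) \<cdot> x = f \<cdot> z" "(s\<^sub>1 \<cdot> v) \<cdot> x = g \<cdot> z"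
      using Comp_assoc[OF x(1) u r(1)] Comp_assoc[OF x(1) v s(1)] x i j by auto
    then obtain h where h: "h \<in> Hom C T W" "b \<cdot> h = x" "w \<cdot> h = z" using W[OF x(1) z] by auto
    have "d \<cdot> h = e"
      unfolding d_def using Comp_assoc[OF h(1) ub r(2)] Comp_assoc[OF h(1) b u] h x i by auto
    then show "\<exists>h \<in> Hom C T W. w \<cdot> h = z \<and> d \<cdot> h = e" using h by auto
  next
    fix T h h'
    assume h: "h \<in> Hom C T W" "h' \<in> Hom C T W" and eq: "w \<cdot> h = w \<cdot> h'" "d \<cdot> h = d \<cdot> h'"
    have bh: "b \<cdot> h \<in> Hom C T V" "b \<cdot> h' \<in> Hom C T V" using h Comp_in_Hom[OF _ b] by auto
    have ubh: "(u \<cdot> b) \<cdot> h \<in> Hom C T R" "(u \<cdot> b) \<cdot> h' \<in> Hom C T R"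
      "(v \<cdot> b) \<cdot> h \<in> Hom C T S" "(v \<cdot> b) \<cdot> h' \<in> Hom C T S" using h Comp_in_Hom[OF _ ub] Comp_in_Hom[OF _ vb]
    by auto
    \<comment> \<open>The elements of \<open>R\<close> and \<open>S\<close> stored in
      \<open>W\<close> are determined by their ends, and these are expressed by \<open>w\<close> and
      \<open>d\<close>.\<close>
    have "(u \<cdot> b) \<cdot> h = (u \<cdot> b) \<cdot> h'"
    proof (rule relation_ext[OF R ubh(1,2)])
      show "r\<^sub>1 \<cdot> ((u \<cdot> b) \<cdot> h) = r\<^sub>1 \<cdot> ((u \<cdot> b) \<cdot> h')"
        using Comp_eq_Comp[OF bw'(1) ub r(1) w f] h eq by metis
      show "r\<^sub>2 \<cdot> ((u \<cdot> b) \<cdot> h) = r\<^sub>2 \<cdot> ((u \<cdot> b) \<cdot> h')"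
        using Comp_assoc[OF _ ub r(2)] h eq unfolding d_def by metis
    qed
    moreover have "(v \<cdot> b) \<cdot> h = (v \<cdot> b) \<cdot> h'"
    proof (rule relation_ext[OF S ubh(3,4)])
      show "s\<^sub>1 \<cdot> ((v \<cdot> b) \<cdot> h) = s\<^sub>1 \<cdot> ((v \<cdot> b) \<cdot> h')"
        using Comp_eq_Comp[OF bw'(2) vb s(1) w g] h eq by metis
      show "s\<^sub>2 \<cdot> ((v \<cdot> b) \<cdot> h) = s\<^sub>2 \<cdot> ((v \<cdot> b) \<cdot> h')"
        using Comp_assoc[OF _ vb s(2)] h eq unfolding d' by metis
    qed
    ultimately have "b \<cdot> h = b \<cdot> h'"
      using V_ext[OF bh] Comp_assoc[OF h(1) b u] Comp_assoc[OF h(2) b u]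
        Comp_assoc[OF h(1) b v] Comp_assoc[OF h(2) b v] by auto
    then show "h = h'" using W_ext[OF h] eq by auto
  qed
qed

end

section \<open>Zero arrows, kernels and zero classes\<close>

context pointed_category
begin

text \<open>Factorizations through two different zero objects are compared along the unique arrow
  between these objects; this justifies the definite description in \<open>zero_arr\<close>.\<close>

lemma zero_arr_unique:
  assumes "is_zero_object C Z" "g \<in> Hom C X Z" "h \<in> Hom C Z Y"
  shows "zero_arr C X Y = h \<cdot> g"
  unfolding zero_arr_def
proof (rule the_equality)
  show "\<exists>Z' g' h'. is_zero_object C Z' \<and> g' \<in> Hom C X Z' \<and> h' \<in> Hom C Z' Y \<and> h \<cdot> g = h' \<cdot> g'"
    using assms by auto
next
  fix f
  assume "\<exists>Z' g' h'. is_zero_object C Z' \<and> g' \<in> Hom C X Z' \<and> h' \<in> Hom C Z' Y \<and> f = h' \<cdot> g'"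
  then obtain Z' g' h' where 1: "is_zero_object C Z'" "g' \<in> Hom C X Z'" "h' \<in> Hom C Z' Y"
    "f = h' \<cdot> g'" by auto
  have objs: "X \<in> Obj C" "Y \<in> Obj C" "Z \<in> Obj C"
    using Hom_objs assms(2,3) by auto
  obtain t where t: "t \<in> Hom C Z Z'" using 1(1) objs unfolding is_zero_object_def by blast
  have "t \<cdot> g = g'"
    using 1(1,2) Comp_in_Hom[OF assms(2) t] objs unfolding is_zero_object_def by blast
  moreover have "h' \<cdot> t = h"
    using assms(1,3) Comp_in_Hom[OF t 1(3)] objs unfolding is_zero_object_def by blast
  ultimately show "f = h \<cdot> g" using 1(4) Comp_assoc[OF assms(2) t 1(3)] by auto
qed

lemma zero_arr_factors:
  assumes "X \<in> Obj C" "Y \<in> Obj C"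
  obtains Z g h where "is_zero_object C Z" "g \<in> Hom C X Z" "h \<in> Hom C Z Y" "zero_arr C X Y = h \<cdot> g"
proof -
  obtain Z where Z: "is_zero_object C Z" using zero_object_exists by auto
  obtain g h where "g \<in> Hom C X Z" "h \<in> Hom C Z Y"
    using Z assms unfolding is_zero_object_def by metis
  then show thesis using that[OF Z] zero_arr_unique[OF Z] by auto
qed

lemma zero_arr_in_Hom: "X \<in> Obj C \<Longrightarrow> Y \<in> Obj C \<Longrightarrow> zero_arr C X Y \<in> Hom C X Y"
  by (metis zero_arr_factors Comp_in_Hom)

lemma zero_arr_Comp:
  assumes "f \<in> Hom C T X" "Y \<in> Obj C"
  shows "zero_arr C X Y \<cdot> f = zero_arr C T Y"
proof -
  have "X \<in> Obj C" using Hom_objs assms by auto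
  then obtain Z g h where Z: "is_zero_object C Z" "g \<in> Hom C X Z" "h \<in> Hom C Z Y"
    "zero_arr C X Y = h \<cdot> g" using zero_arr_factors assms(2) by metis
  then show ?thesis
    using zero_arr_unique[OF Z(1) Comp_in_Hom[OF assms(1) Z(2)] Z(3)]
      Comp_assoc[OF assms(1) Z(2,3)] by auto
qed

lemma Comp_zero_arr:
  assumes "f \<in> Hom C X Y" "T \<in> Obj C"
  shows "f \<cdot> zero_arr C T X = zero_arr C T Y"
proof -
  have "X \<in> Obj C" using Hom_objs assms by auto
  then obtain Z g h where Z: "is_zero_object C Z" "g \<in> Hom C T Z" "h \<in> Hom C Z X"
    "zero_arr C T X = h \<cdot> g" using zero_arr_factors assms(2) by metis
  then show ?thesis
    using zero_arr_unique[OF Z(1) Z(2) Comp_in_Hom[OF Z(3) assms(1)]]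
      Comp_assoc[OF Z(2,3) assms(1)] by auto
qed

text \<open>The candidate kernel is the arrow out of a zero object; an arrow factors through it
  exactly when it is zero.\<close>

lemma has_zero_kernelI:
  assumes f: "f \<in> Hom C B A"
    and ker: "\<And>T g. g \<in> Hom C T B \<Longrightarrow> f \<cdot> g = zero_arr C T A \<Longrightarrow> g = zero_arr C T B"
  shows "has_zero_kernel C f"
proof -
  have obj: "B \<in> Obj C" "A \<in> Obj C" using Hom_objs f by auto
  obtain Z where Z: "is_zero_object C Z" using zero_object_exists by auto
  then obtain k where k: "k \<in> Hom C Z B" using obj unfolding is_zero_object_def by blast
  have ZO: "Z \<in> Obj C" using Z by (auto simp: is_zero_object_def)
  have D: "Dom C k = Z" "Dom C f = B" "Cod C f = A" "f \<in> Arr C" using k f by (auto simp: Hom_iff)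
  have "k = k \<cdot> Id C Z" using Comp_Id[OF k] by auto
  then have kz: "k = zero_arr C Z B" using zero_arr_unique[OF Z Id_in_Hom[OF ZO] k] by auto
  have "\<exists>!h. h \<in> Hom C T Z \<and> k \<cdot> h = g"
    if g: "g \<in> Hom C T B" "f \<cdot> g = zero_arr C T A" for T g
  proof -
    have "T \<in> Obj C" using Hom_objs g by auto
    then have ex1: "\<exists>!h. h \<in> Hom C T Z" using Z by (auto simp: is_zero_object_def)
    then obtain h where h: "h \<in> Hom C T Z" by auto
    then have "k \<cdot> h = g" using zero_arr_unique[OF Z h k] ker[OF g] by auto
    then show ?thesis using ex1 h by blast
  qed
  then have "is_kernel C f k"
    unfolding is_kernel_def D using k D Comp_zero_arr[OF f ZO] kz by auto
  then show ?thesis using Z D unfolding has_zero_kernel_def by auto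
qed

section \<open>Trivial pullbacks and zero classes in terms of elements\<close>

lemma has_trivial_pullbackD:
  assumes "has_trivial_pullback C k l" "k \<in> Hom C X A" "l \<in> Hom C Y A"
    "x \<in> Hom C T X" "y \<in> Hom C T Y" "k \<cdot> x = l \<cdot> y"
  shows "x = zero_arr C T X" "y = zero_arr C T Y"
proof -
  obtain p q where pb: "is_pullback C k l p q" and Z: "is_zero_object C (Dom C p)"
    using assms(1) by (auto simp: has_trivial_pullback_def)
  have D: "Dom C k = X" "Dom C l = Y" using assms by (auto simp: Hom_iff)
  have p: "p \<in> Hom C (Dom C p) X" "q \<in> Hom C (Dom C p) Y"
    using pb by (auto simp: is_pullback_def D)
  obtain h where h: "h \<in> Hom C T (Dom C p)" "p \<cdot> h = x" "q \<cdot> h = y"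
    using pb assms(4-6) unfolding is_pullback_def D by metis
  show "x = zero_arr C T X" "y = zero_arr C T Y"
    using zero_arr_unique[OF Z h(1) p(1)] zero_arr_unique[OF Z h(1) p(2)] h by auto
qed

text \<open>A pair of \<open>h\<close> in \<open>R\<close> and \<open>a\<close> in \<open>A\<close>
  on which the two pairings agree is just an \<open>h\<close> witnessing that \<open>a\<close> is
  related to 0. The pullback property therefore says which \<open>a\<close> are related to
  0.\<close>

lemma bourn_normal_monoE:
  assumes "is_bourn_normal_mono C k" and k: "k \<in> Hom C X A"
  obtains R r\<^sub>1 r\<^sub>2 where "is_equivalence_relation C A R r\<^sub>1 r\<^sub>2"
    "\<And>T a. a \<in> Hom C T A \<Longrightarrow>
      related r\<^sub>1 r\<^sub>2 a (zero_arr C T A) \<longleftrightarrow> (\<exists>x \<in> Hom C T X. a = k \<cdot> x)"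
proof -
  have A: "A \<in> Obj C" using Hom_objs k by auto
  have D: "Cod C k = A" "Dom C k = X" using k by (auto simp: Hom_iff)
  obtain P p q R r\<^sub>1 r\<^sub>2 \<kappa> where P: "is_product C A A P p q"
    and E: "is_equivalence_relation C A R r\<^sub>1 r\<^sub>2"
    and pb: "is_pullback C (pairing C p q r\<^sub>1 r\<^sub>2) (pairing C p q (Id C A) (zero_arr C A A)) \<kappa> k"
    using assms(1) unfolding is_bourn_normal_mono_def D Let_def by auto
  let ?r = "pairing C p q r\<^sub>1 r\<^sub>2" and ?i = "pairing C p q (Id C A) (zero_arr C A A)"
  have r: "r\<^sub>1 \<in> Hom C R A" "r\<^sub>2 \<in> Hom C R A"
    using equivalence_relation[OF E] by (auto simp: is_relation_def)
  have p: "p \<in> Hom C P A" "q \<in> Hom C P A" using P by (auto simp: is_product_def)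
  note pr = pairing[OF P r]
  note pi = pairing[OF P Id_in_Hom[OF A] zero_arr_in_Hom[OF A A]]
  have Dr: "Dom C ?r = R" "Dom C ?i = A" using pr(1) pi(1) by (auto simp: Hom_iff)
  have \<kappa>: "\<kappa> \<in> Hom C X R" "?r \<cdot> \<kappa> = ?i \<cdot> k"
    using pb Dr k by (auto simp: is_pullback_def Hom_iff)
  have rp: "r\<^sub>1 \<cdot> h = p \<cdot> (?r \<cdot> h)" "r\<^sub>2 \<cdot> h = q \<cdot> (?r \<cdot> h)" if "h \<in> Hom C T R" for T h
    using Comp_assoc[OF that pr(1) p(1)] Comp_assoc[OF that pr(1) p(2)] pr by auto
  have ip: "p \<cdot> (?i \<cdot> a) = a" "q \<cdot> (?i \<cdot> a) = zero_arr C T A" if "a \<in> Hom C T A" for T a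
    using Comp_assoc[OF that pi(1) p(1)] Comp_assoc[OF that pi(1) p(2)] pi Id_Comp[OF that]
      zero_arr_Comp[OF that A] by auto
  show thesis
  proof (rule that[OF E])
    fix T a assume a: "a \<in> Hom C T A"
    show "related r\<^sub>1 r\<^sub>2 a (zero_arr C T A) \<longleftrightarrow> (\<exists>x \<in> Hom C T X. a = k \<cdot> x)"
    proof
      assume "related r\<^sub>1 r\<^sub>2 a (zero_arr C T A)"
      then obtain h where h: "h \<in> Hom C T R" "r\<^sub>1 \<cdot> h = a" "r\<^sub>2 \<cdot> h = zero_arr C T A"
        using relatedE a r by metis
      have "?r \<cdot> h = ?i \<cdot> a"
        using product_ext[OF P Comp_in_Hom[OF h(1) pr(1)] Comp_in_Hom[OF a pi(1)]]
          rp[OF h(1)] ip[OF a] h by auto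
      moreover have "Dom C \<kappa> = X" using \<kappa> by (auto simp: Hom_iff)
      ultimately have "\<exists>!x. x \<in> Hom C T X \<and> \<kappa> \<cdot> x = h \<and> k \<cdot> x = a"
        using pb h(1) a Dr unfolding is_pullback_def by auto
      then show "\<exists>x \<in> Hom C T X. a = k \<cdot> x" by auto
    next
      assume "\<exists>x \<in> Hom C T X. a = k \<cdot> x"
      then obtain x where x: "x \<in> Hom C T X" "a = k \<cdot> x" by auto
      have "?r \<cdot> (\<kappa> \<cdot> x) = ?i \<cdot> a"
        using Comp_eq_Comp[OF \<kappa>(2) \<kappa>(1) pr(1) k pi(1) x(1)] x by auto
      then show "related r\<^sub>1 r\<^sub>2 a (zero_arr C T A)"
        using relatedI[OF Comp_in_Hom[OF x(1) \<kappa>(1)] r(1)] rp[OF Comp_in_Hom[OF x(1) \<kappa>(1)]]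
          ip[OF a] by auto
    qed
  qed
qed

text \<open>Here the pullback square is rebuilt from its elements: joint monicity of
  \<open>R\<close> identifies the leg into \<open>R\<close>, and monicity of \<open>k\<close> gives
  uniqueness.\<close>

lemma bourn_normal_monoI:
  assumes k: "k \<in> Hom C X A" and mono: "is_mono C k" and P: "is_product C A A P p q"
    and E: "is_equivalence_relation C A R r\<^sub>1 r\<^sub>2"
    and zero_class: "\<And>T a. a \<in> Hom C T A \<Longrightarrow>
      related r\<^sub>1 r\<^sub>2 a (zero_arr C T A) \<longleftrightarrow> (\<exists>x \<in> Hom C T X. a = k \<cdot> x)"
  shows "is_bourn_normal_mono C k"
proof -
  have A: "A \<in> Obj C" and X: "X \<in> Obj C" using Hom_objs k by auto
  have D: "Cod C k = A" "Dom C k = X" using k by (auto simp: Hom_iff)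
  let ?r = "pairing C p q r\<^sub>1 r\<^sub>2" and ?i = "pairing C p q (Id C A) (zero_arr C A A)"
  have r: "r\<^sub>1 \<in> Hom C R A" "r\<^sub>2 \<in> Hom C R A"
    using equivalence_relation[OF E] by (auto simp: is_relation_def)
  have p: "p \<in> Hom C P A" "q \<in> Hom C P A" using P by (auto simp: is_product_def)
  note pr = pairing[OF P r]
  note pi = pairing[OF P Id_in_Hom[OF A] zero_arr_in_Hom[OF A A]]
  have Dr: "Dom C ?r = R" "Dom C ?i = A" "Cod C ?r = P" "Cod C ?i = P" "?r \<in> Arr C" "?i \<in> Arr C"
    using pr(1) pi(1) by (auto simp: Hom_iff)
  have rp: "r\<^sub>1 \<cdot> h = p \<cdot> (?r \<cdot> h)" "r\<^sub>2 \<cdot> h = q \<cdot> (?r \<cdot> h)" if "h \<in> Hom C T R" for T h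
    using Comp_assoc[OF that pr(1) p(1)] Comp_assoc[OF that pr(1) p(2)] pr by auto
  have ip: "p \<cdot> (?i \<cdot> a) = a" "q \<cdot> (?i \<cdot> a) = zero_arr C T A" if "a \<in> Hom C T A" for T a
    using Comp_assoc[OF that pi(1) p(1)] Comp_assoc[OF that pi(1) p(2)] pi Id_Comp[OF that]
      zero_arr_Comp[OF that A] by auto
  \<comment> \<open>The generic element of the zero class is \<open>k\<close> itself, and its
    witness is the missing side \<open>\<kappa>\<close> of the square.\<close>
  have "related r\<^sub>1 r\<^sub>2 k (zero_arr C X A)"
    using zero_class[OF k] Id_in_Hom[OF X] Comp_Id[OF k] by metis
  then obtain \<kappa> where \<kappa>: "\<kappa> \<in> Hom C X R" "r\<^sub>1 \<cdot> \<kappa> = k" "r\<^sub>2 \<cdot> \<kappa> = zero_arr C X A"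
    using relatedE k r by metis
  have D\<kappa>: "Dom C \<kappa> = X" using \<kappa> by (auto simp: Hom_iff)
  have comm: "?r \<cdot> \<kappa> = ?i \<cdot> k"
    using product_ext[OF P Comp_in_Hom[OF \<kappa>(1) pr(1)] Comp_in_Hom[OF k pi(1)]]
      rp[OF \<kappa>(1)] ip[OF k] \<kappa> by auto
  have univ: "\<exists>!h. h \<in> Hom C T X \<and> \<kappa> \<cdot> h = a \<and> k \<cdot> h = b"
    if ab: "a \<in> Hom C T R" "b \<in> Hom C T A" "?r \<cdot> a = ?i \<cdot> b" for T a b
  proof -
    have ra: "r\<^sub>1 \<cdot> a = b" "r\<^sub>2 \<cdot> a = zero_arr C T A"
      using rp[OF ab(1)] ip[OF ab(2)] ab(3) by auto
    then have "related r\<^sub>1 r\<^sub>2 b (zero_arr C T A)" using relatedI ab(1) r(1) by metis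
    then obtain x where x: "x \<in> Hom C T X" "b = k \<cdot> x" using zero_class[OF ab(2)] by auto
    have "\<kappa> \<cdot> x = a"
    proof (rule relation_ext[OF equivalence_relation[OF E] Comp_in_Hom[OF x(1) \<kappa>(1)] ab(1)])
      show "r\<^sub>1 \<cdot> \<kappa> \<cdot> x = r\<^sub>1 \<cdot> a"
        using Comp_assoc[OF x(1) \<kappa>(1) r(1)] \<kappa> x ra by auto
      show "r\<^sub>2 \<cdot> \<kappa> \<cdot> x = r\<^sub>2 \<cdot> a"
        using Comp_assoc[OF x(1) \<kappa>(1) r(2)] \<kappa> x ra zero_arr_Comp[OF x(1) A] by auto
    qed
    then show ?thesis using x is_monoD[OF mono k] by metis
  qed
  have "is_pullback C ?r ?i \<kappa> k"
    unfolding is_pullback_def Dr D\<kappa> using Dr k \<kappa>(1) comm univ by auto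
  then show ?thesis
    unfolding is_bourn_normal_mono_def D Let_def using mono P E by blast
qed

end

section \<open>Difunctionality and unitality\<close>

context pointed_maltsev_category
begin

text \<open>A product is a pullback over a zero object, where all squares commute.\<close>

lemma product_exists:
  assumes "X \<in> Obj C" "Y \<in> Obj C"
  obtains P p q where "is_product C X Y P p q"
proof -
  obtain Z where Z: "is_zero_object C Z" using zero_object_exists by auto
  obtain f g where f: "f \<in> Hom C X Z" and g: "g \<in> Hom C Y Z"
    using Z assms unfolding is_zero_object_def by metis
  obtain P p q where p: "p \<in> Hom C P X" and q: "q \<in> Hom C P Y"
    and ex: "\<And>T a b. a \<in> Hom C T X \<Longrightarrow> b \<in> Hom C T Y \<Longrightarrow> f \<cdot> a = g \<cdot> b \<Longrightarrow>
       \<exists>h \<in> Hom C T P. p \<cdot> h = a \<and> q \<cdot> h = b"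
    and ext: "\<And>T h h'. h \<in> Hom C T P \<Longrightarrow> h' \<in> Hom C T P \<Longrightarrow> p \<cdot> h = p \<cdot> h' \<Longrightarrow> q \<cdot> h = q \<cdot> h' \<Longrightarrow>
      h = h'"
    by (rule pullback_exists[OF f g], rule that)
  have "\<exists>!h. h \<in> Hom C T P \<and> p \<cdot> h = a \<and> q \<cdot> h = b"
    if a: "a \<in> Hom C T X" and b: "b \<in> Hom C T Y" for T a b
  proof -
    have "T \<in> Obj C" using Hom_objs[OF a] by auto
    then have "f \<cdot> a = g \<cdot> b"
      using Z Comp_in_Hom[OF a f] Comp_in_Hom[OF b g] unfolding is_zero_object_def by blast
    then show ?thesis using ex[OF a b] ext by metis
  qed
  then have "is_product C X Y P p q" unfolding is_product_def using p q by auto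
  then show thesis by (rule that)
qed

text \<open>The relation ``\<open>w\<^sub>1 i\<close> is related to \<open>w\<^sub>2 j\<close>'' between elements \<open>i\<close> and \<open>j\<close> of \<open>W\<close> itself
  is reflexive, hence symmetric.\<close>

lemma difunctional:
  assumes w: "w\<^sub>1 \<in> Hom C W X" "w\<^sub>2 \<in> Hom C W Y"
    and w_ext: "\<And>T f g. f \<in> Hom C T W \<Longrightarrow> g \<in> Hom C T W \<Longrightarrow> w\<^sub>1 \<cdot> f = w\<^sub>1 \<cdot> g \<Longrightarrow>
      w\<^sub>2 \<cdot> f = w\<^sub>2 \<cdot> g \<Longrightarrow> f = g"
    and i: "i \<in> Hom C T W" and j: "j \<in> Hom C T W" and m: "m \<in> Hom C T W"
    and im: "w\<^sub>2 \<cdot> i = w\<^sub>2 \<cdot> m" and mj: "w\<^sub>1 \<cdot> m = w\<^sub>1 \<cdot> j"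
  obtains h where "h \<in> Hom C T W" "w\<^sub>1 \<cdot> h = w\<^sub>1 \<cdot> i" "w\<^sub>2 \<cdot> h = w\<^sub>2 \<cdot> j"
proof -
  have W: "W \<in> Obj C" using Hom_objs[OF w(1)] by auto
  obtain P p q where P: "is_product C W W P p q" using product_exists[OF W W] .
  have p: "p \<in> Hom C P W" and q: "q \<in> Hom C P W" using P by (auto simp: is_product_def)
  obtain M v n where v: "v \<in> Hom C M P" and n: "n \<in> Hom C M W"
    and vn: "(w\<^sub>1 \<cdot> p) \<cdot> v = w\<^sub>1 \<cdot> n" "(w\<^sub>2 \<cdot> q) \<cdot> v = w\<^sub>2 \<cdot> n"
    and M: "\<And>T a b. a \<in> Hom C T P \<Longrightarrow> b \<in> Hom C T W \<Longrightarrow> (w\<^sub>1 \<cdot> p) \<cdot> a = w\<^sub>1 \<cdot> b \<Longrightarrow>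
      (w\<^sub>2 \<cdot> q) \<cdot> a = w\<^sub>2 \<cdot> b \<Longrightarrow> \<exists>h \<in> Hom C T M. v \<cdot> h = a \<and> n \<cdot> h = b"
    and M_ext: "\<And>T h h'. h \<in> Hom C T M \<Longrightarrow> h' \<in> Hom C T M \<Longrightarrow> v \<cdot> h = v \<cdot> h' \<Longrightarrow> n \<cdot> h = n \<cdot> h' \<Longrightarrow>
      h = h'"
    by (rule double_pullback_exists[OF Comp_in_Hom[OF p w(1)] Comp_in_Hom[OF q w(2)] w], rule that)
  have pv: "p \<cdot> v \<in> Hom C M W" and qv: "q \<cdot> v \<in> Hom C M W"
    using Comp_in_Hom[OF v p] Comp_in_Hom[OF v q] .
  have vn': "w\<^sub>1 \<cdot> (p \<cdot> v) = w\<^sub>1 \<cdot> n" "w\<^sub>2 \<cdot> (q \<cdot> v) = w\<^sub>2 \<cdot> n"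
    using vn Comp_assoc[OF v p w(1)] Comp_assoc[OF v q w(2)] by auto
  have related: "related (p \<cdot> v) (q \<cdot> v) a b"
    if a: "a \<in> Hom C U W" and b: "b \<in> Hom C U W" and c: "c \<in> Hom C U W"
      and eq: "w\<^sub>1 \<cdot> a = w\<^sub>1 \<cdot> c" "w\<^sub>2 \<cdot> b = w\<^sub>2 \<cdot> c" for U a b c
  proof -
    note ab = pairing[OF P a b]
    obtain h where h: "h \<in> Hom C U M" "v \<cdot> h = pairing C p q a b"
      using M[OF ab(1) c] Comp_assoc[OF ab(1) p w(1)] Comp_assoc[OF ab(1) q w(2)] ab eq by auto
    show ?thesis
      using relatedI[OF h(1) pv] Comp_assoc[OF h(1) v p] Comp_assoc[OF h(1) v q] h ab by auto
  qed
  have rel: "is_relation C W M (p \<cdot> v) (q \<cdot> v)"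
    unfolding is_relation_def
  proof (intro conjI allI ballI impI pv qv)
    fix U f g
    assume f: "f \<in> Hom C U M" and g: "g \<in> Hom C U M"
      and eq: "(p \<cdot> v) \<cdot> f = (p \<cdot> v) \<cdot> g \<and> (q \<cdot> v) \<cdot> f = (q \<cdot> v) \<cdot> g"
    have "v \<cdot> f = v \<cdot> g"
      using product_ext[OF P Comp_in_Hom[OF f v] Comp_in_Hom[OF g v]] eq
        Comp_assoc[OF f v p] Comp_assoc[OF g v p] Comp_assoc[OF f v q] Comp_assoc[OF g v q] by auto
    moreover have "n \<cdot> f = n \<cdot> g"
      using w_ext[OF Comp_in_Hom[OF f n] Comp_in_Hom[OF g n]] eq
        Comp_eq_Comp[OF vn'(1) pv w(1) n w(1) f] Comp_eq_Comp[OF vn'(1) pv w(1) n w(1) g]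
        Comp_eq_Comp[OF vn'(2) qv w(2) n w(2) f] Comp_eq_Comp[OF vn'(2) qv w(2) n w(2) g] by auto
    ultimately show "f = g" using M_ext[OF f g] by auto
  qed
  have IW: "Id C W \<in> Hom C W W" using Id_in_Hom[OF W] .
  have "related (p \<cdot> v) (q \<cdot> v) (Id C W) (Id C W)" using related[OF IW IW IW] by auto
  then have "is_reflexive_relation C W M (p \<cdot> v) (q \<cdot> v)"
    unfolding is_reflexive_relation_def using rel relatedE[OF _ IW pv] by metis
  then have E: "is_equivalence_relation C W M (p \<cdot> v) (q \<cdot> v)" by (rule reflexive_imp_equivalence)
  \<comment> \<open>The assumptions make \<open>m\<close> a witness for the pair in the order
    \<open>(j, i)\<close>; after symmetry, the witness for \<open>(i, j)\<close> is the required
    element.\<close>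
  have "related (p \<cdot> v) (q \<cdot> v) j i" using related[OF j i m] im mj by auto
  then have "related (p \<cdot> v) (q \<cdot> v) i j" by (rule related_sym[OF E j])
  then obtain h where h: "h \<in> Hom C T M" "(p \<cdot> v) \<cdot> h = i" "(q \<cdot> v) \<cdot> h = j"
    using relatedE[OF _ i pv] by metis
  show thesis
    using that[OF Comp_in_Hom[OF h(1) n]] h
      Comp_eq_Comp[OF vn'(1) pv w(1) n w(1) h(1)] Comp_eq_Comp[OF vn'(2) qv w(2) n w(2) h(1)]
    by auto
qed

text \<open>Regard \<open>W\<close> as a relation between \<open>X\<close> and \<open>Y\<close>.
  Difunctionality turns its elements \<open>(x, 0)\<close>, \<open>(0, 0)\<close> and
  \<open>(0, y)\<close> into \<open>(x, y)\<close>; for the generic pair this is a section of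
  \<open>w\<close>.\<close>

lemma axes_jointly_strongly_epic:
  assumes P: "is_product C X Y P p q" and w: "w \<in> Hom C W P" "is_mono C w"
    and h\<^sub>1: "h\<^sub>1 \<in> Hom C X W" "w \<cdot> h\<^sub>1 = pairing C p q (Id C X) (zero_arr C X Y)"
    and h\<^sub>2: "h\<^sub>2 \<in> Hom C Y W" "w \<cdot> h\<^sub>2 = pairing C p q (zero_arr C Y X) (Id C Y)"
  obtains h where "h \<in> Hom C P W" "w \<cdot> h = Id C P"
proof -
  have p: "p \<in> Hom C P X" and q: "q \<in> Hom C P Y" using P by (auto simp: is_product_def)
  have X: "X \<in> Obj C" and Y: "Y \<in> Obj C" and PO: "P \<in> Obj C"
    using Hom_objs[OF p] Hom_objs[OF q] by auto
  note IX = Id_in_Hom[OF X] and IY = Id_in_Hom[OF Y]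
  note i\<^sub>1 = pairing[OF P IX zero_arr_in_Hom[OF X Y]]
  note i\<^sub>2 = pairing[OF P zero_arr_in_Hom[OF Y X] IY]
  have pw: "p \<cdot> w \<in> Hom C W X" and qw: "q \<cdot> w \<in> Hom C W Y"
    using Comp_in_Hom[OF w(1) p] Comp_in_Hom[OF w(1) q] .
  have a: "(p \<cdot> w) \<cdot> h\<^sub>1 = Id C X" "(q \<cdot> w) \<cdot> h\<^sub>1 = zero_arr C X Y"
    "(p \<cdot> w) \<cdot> h\<^sub>2 = zero_arr C Y X" "(q \<cdot> w) \<cdot> h\<^sub>2 = Id C Y"
    using Comp_assoc[OF h\<^sub>1(1) w(1) p] Comp_assoc[OF h\<^sub>1(1) w(1) q] Comp_assoc[OF h\<^sub>2(1) w(1) p]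
      Comp_assoc[OF h\<^sub>2(1) w(1) q] h\<^sub>1 h\<^sub>2 i\<^sub>1 i\<^sub>2 by auto
  have z: "zero_arr C P X \<in> Hom C P X" using zero_arr_in_Hom[OF PO X] .
  have b: "(p \<cdot> w) \<cdot> (h\<^sub>1 \<cdot> p) = p" "(q \<cdot> w) \<cdot> (h\<^sub>1 \<cdot> p) = zero_arr C P Y"
    "(p \<cdot> w) \<cdot> (h\<^sub>2 \<cdot> q) = zero_arr C P X" "(q \<cdot> w) \<cdot> (h\<^sub>2 \<cdot> q) = q"
    "(p \<cdot> w) \<cdot> (h\<^sub>1 \<cdot> zero_arr C P X) = zero_arr C P X"
    "(q \<cdot> w) \<cdot> (h\<^sub>1 \<cdot> zero_arr C P X) = zero_arr C P Y"
    using Comp_assoc[OF p h\<^sub>1(1) pw] Comp_assoc[OF p h\<^sub>1(1) qw] Comp_assoc[OF q h\<^sub>2(1) pw]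
      Comp_assoc[OF q h\<^sub>2(1) qw] Comp_assoc[OF z h\<^sub>1(1) pw] Comp_assoc[OF z h\<^sub>1(1) qw] a
      Id_Comp[OF p] Id_Comp[OF q] Id_Comp[OF z] zero_arr_Comp[OF p Y] zero_arr_Comp[OF q X]
      zero_arr_Comp[OF z Y] by auto
  have ext: "f = g" if f: "f \<in> Hom C T W" and g: "g \<in> Hom C T W"
    and eq: "(p \<cdot> w) \<cdot> f = (p \<cdot> w) \<cdot> g" "(q \<cdot> w) \<cdot> f = (q \<cdot> w) \<cdot> g" for T f g
  proof -
    have "w \<cdot> f = w \<cdot> g"
      using product_ext[OF P Comp_in_Hom[OF f w(1)] Comp_in_Hom[OF g w(1)]] eq
        Comp_assoc[OF f w(1) p] Comp_assoc[OF g w(1) p] Comp_assoc[OF f w(1) q]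
        Comp_assoc[OF g w(1) q] by auto
    then show ?thesis using is_monoD[OF w(2,1) f g] by auto
  qed
  \<comment> \<open>The elements \<open>h\<^sub>1 \<cdot> p\<close>, \<open>h\<^sub>1\<close> after
    zero, and \<open>h\<^sub>2 \<cdot> q\<close> lie over \<open>(x, 0)\<close>,
    \<open>(0, 0)\<close> and \<open>(0, y)\<close>.\<close>
  obtain h where h: "h \<in> Hom C P W" "(p \<cdot> w) \<cdot> h = (p \<cdot> w) \<cdot> (h\<^sub>1 \<cdot> p)"
    "(q \<cdot> w) \<cdot> h = (q \<cdot> w) \<cdot> (h\<^sub>2 \<cdot> q)"
  proof (rule difunctional[OF pw qw ext Comp_in_Hom[OF p h\<^sub>1(1)] Comp_in_Hom[OF q h\<^sub>2(1)]
        Comp_in_Hom[OF z h\<^sub>1(1)]])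
    show "(q \<cdot> w) \<cdot> (h\<^sub>1 \<cdot> p) = (q \<cdot> w) \<cdot> (h\<^sub>1 \<cdot> zero_arr C P X)" using b by simp
    show "(p \<cdot> w) \<cdot> (h\<^sub>1 \<cdot> zero_arr C P X) = (p \<cdot> w) \<cdot> (h\<^sub>2 \<cdot> q)" using b by simp
  qed
  have "w \<cdot> h = Id C P"
    using product_ext[OF P Comp_in_Hom[OF h(1) w(1)] Id_in_Hom[OF PO]] Comp_assoc[OF h(1) w(1) p]
      Comp_assoc[OF h(1) w(1) q] h b Comp_Id[OF p] Comp_Id[OF q] by auto
  then show thesis using that h by auto
qed

text \<open>The pullback of \<open>m\<close> along \<open>\<phi>\<close> is a subobject of
  \<open>P\<close> containing both axes, hence has a section. This gives the minimality of the
  join.\<close>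

lemma factors_if_axes_factor:
  assumes P: "is_product C X Y P p q" and \<phi>: "\<phi> \<in> Hom C P A"
    and m: "m \<in> Hom C M A" "is_mono C m"
    and f: "f \<in> Hom C X M" "\<phi> \<cdot> pairing C p q (Id C X) (zero_arr C X Y) = m \<cdot> f"
    and g: "g \<in> Hom C Y M" "\<phi> \<cdot> pairing C p q (zero_arr C Y X) (Id C Y) = m \<cdot> g"
  obtains h where "h \<in> Hom C P M" "m \<cdot> h = \<phi>"
proof -
  have X: "X \<in> Obj C" and Y: "Y \<in> Obj C" using Hom_objs f(1) g(1) by auto
  note i\<^sub>1 = pairing[OF P Id_in_Hom[OF X] zero_arr_in_Hom[OF X Y]]
  note i\<^sub>2 = pairing[OF P zero_arr_in_Hom[OF Y X] Id_in_Hom[OF Y]]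
  obtain W w n where w: "w \<in> Hom C W P" and n: "n \<in> Hom C W M" and wn: "\<phi> \<cdot> w = m \<cdot> n"
    and W: "\<And>T a b. a \<in> Hom C T P \<Longrightarrow> b \<in> Hom C T M \<Longrightarrow> \<phi> \<cdot> a = m \<cdot> b \<Longrightarrow>
       \<exists>h \<in> Hom C T W. w \<cdot> h = a \<and> n \<cdot> h = b"
    and W_ext: "\<And>T h h'. h \<in> Hom C T W \<Longrightarrow> h' \<in> Hom C T W \<Longrightarrow> w \<cdot> h = w \<cdot> h' \<Longrightarrow> n \<cdot> h = n \<cdot> h' \<Longrightarrow>
      h = h'"
    by (rule pullback_exists[OF \<phi> m(1)], rule that)
  have mono: "is_mono C w"
  proof (rule is_monoI[OF w])
    fix T a b assume a: "a \<in> Hom C T W" and b: "b \<in> Hom C T W" and eq: "w \<cdot> a = w \<cdot> b"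
    have "n \<cdot> a = n \<cdot> b"
      using is_monoD[OF m(2,1) Comp_in_Hom[OF a n] Comp_in_Hom[OF b n]] eq
        Comp_eq_Comp[OF wn w \<phi> n m(1) a] Comp_eq_Comp[OF wn w \<phi> n m(1) b] by auto
    then show "a = b" using W_ext[OF a b eq] by auto
  qed
  obtain h\<^sub>1 where h\<^sub>1: "h\<^sub>1 \<in> Hom C X W" "w \<cdot> h\<^sub>1 = pairing C p q (Id C X) (zero_arr C X Y)"
    using W[OF i\<^sub>1(1) f] by auto
  obtain h\<^sub>2 where h\<^sub>2: "h\<^sub>2 \<in> Hom C Y W" "w \<cdot> h\<^sub>2 = pairing C p q (zero_arr C Y X) (Id C Y)"
    using W[OF i\<^sub>2(1) g] by auto
  obtain h where h: "h \<in> Hom C P W" "w \<cdot> h = Id C P"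
    using axes_jointly_strongly_epic[OF P w mono h\<^sub>1 h\<^sub>2] .
  have "m \<cdot> (n \<cdot> h) = \<phi>"
    using Comp_eq_Comp[OF wn w \<phi> n m(1) h(1)] h Comp_Id[OF \<phi>] by auto
  then show thesis using that Comp_in_Hom[OF h(1) n] by auto
qed

text \<open>The equalizer of the two arrows contains both axes, hence has a section. This gives the
  uniqueness of cooperators.\<close>

lemma axes_jointly_epic:
  assumes P: "is_product C X Y P p q" and \<phi>: "\<phi> \<in> Hom C P A" and \<psi>: "\<psi> \<in> Hom C P A"
    and X_eq: "\<phi> \<cdot> pairing C p q (Id C X) (zero_arr C X Y) =
      \<psi> \<cdot> pairing C p q (Id C X) (zero_arr C X Y)"
    and Y_eq: "\<phi> \<cdot> pairing C p q (zero_arr C Y X) (Id C Y) =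
      \<psi> \<cdot> pairing C p q (zero_arr C Y X) (Id C Y)"
  shows "\<phi> = \<psi>"
proof -
  have p: "p \<in> Hom C P X" and q: "q \<in> Hom C P Y" using P by (auto simp: is_product_def)
  have X: "X \<in> Obj C" and Y: "Y \<in> Obj C" and A: "A \<in> Obj C"
    using Hom_objs p q \<phi> by auto
  note i\<^sub>1 = pairing[OF P Id_in_Hom[OF X] zero_arr_in_Hom[OF X Y]]
  note i\<^sub>2 = pairing[OF P zero_arr_in_Hom[OF Y X] Id_in_Hom[OF Y]]
  note IA = Id_in_Hom[OF A]
  \<comment> \<open>With identities on the other side, the double pullback is the equalizer of
    \<open>\<phi>\<close> and \<open>\<psi>\<close>, and \<open>n\<close> is their common
    value.\<close>
  obtain W w n where w: "w \<in> Hom C W P" and n: "n \<in> Hom C W A"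
    and wn: "\<phi> \<cdot> w = Id C A \<cdot> n" "\<psi> \<cdot> w = Id C A \<cdot> n"
    and W: "\<And>T a b. a \<in> Hom C T P \<Longrightarrow> b \<in> Hom C T A \<Longrightarrow> \<phi> \<cdot> a = Id C A \<cdot> b \<Longrightarrow>
      \<psi> \<cdot> a = Id C A \<cdot> b \<Longrightarrow> \<exists>h \<in> Hom C T W. w \<cdot> h = a \<and> n \<cdot> h = b"
    and W_ext: "\<And>T h h'. h \<in> Hom C T W \<Longrightarrow> h' \<in> Hom C T W \<Longrightarrow> w \<cdot> h = w \<cdot> h' \<Longrightarrow> n \<cdot> h = n \<cdot> h' \<Longrightarrow>
      h = h'"
    by (rule double_pullback_exists[OF \<phi> \<psi> IA IA], rule that)
  have n_eq: "n = \<phi> \<cdot> w" using wn Id_Comp[OF n] by auto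
  have mono: "is_mono C w"
  proof (rule is_monoI[OF w])
    fix T a b assume a: "a \<in> Hom C T W" and b: "b \<in> Hom C T W" and eq: "w \<cdot> a = w \<cdot> b"
    have "n \<cdot> a = n \<cdot> b"
      unfolding n_eq using Comp_assoc[OF a w \<phi>] Comp_assoc[OF b w \<phi>] eq by auto
    then show "a = b" using W_ext[OF a b eq] by auto
  qed
  obtain h\<^sub>1 where h\<^sub>1: "h\<^sub>1 \<in> Hom C X W" "w \<cdot> h\<^sub>1 = pairing C p q (Id C X) (zero_arr C X Y)"
    using W[OF i\<^sub>1(1) Comp_in_Hom[OF i\<^sub>1(1) \<phi>] Id_Comp[OF Comp_in_Hom[OF i\<^sub>1(1) \<phi>], symmetric]]
      Id_Comp[OF Comp_in_Hom[OF i\<^sub>1(1) \<phi>]] X_eq by metis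
  obtain h\<^sub>2 where h\<^sub>2: "h\<^sub>2 \<in> Hom C Y W" "w \<cdot> h\<^sub>2 = pairing C p q (zero_arr C Y X) (Id C Y)"
    using W[OF i\<^sub>2(1) Comp_in_Hom[OF i\<^sub>2(1) \<phi>] Id_Comp[OF Comp_in_Hom[OF i\<^sub>2(1) \<phi>], symmetric]]
      Id_Comp[OF Comp_in_Hom[OF i\<^sub>2(1) \<phi>]] Y_eq by metis
  obtain h where h: "h \<in> Hom C P W" "w \<cdot> h = Id C P"
    using axes_jointly_strongly_epic[OF P w mono h\<^sub>1 h\<^sub>2] .
  have "\<phi> \<cdot> w = \<psi> \<cdot> w" using wn by auto
  from Comp_eq_Comp[OF this w \<phi> w \<psi> h(1)] show ?thesis
    using h Comp_Id[OF \<phi>] Comp_Id[OF \<psi>] by auto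
qed

end

section \<open>Equivalence relations with disjoint zero classes\<close>

locale disjoint_zero_classes = pointed_maltsev_category +
  fixes X Y A k l R r\<^sub>1 r\<^sub>2 S s\<^sub>1 s\<^sub>2
  assumes zero_kernel_imp_mono: "f \<in> Arr C \<Longrightarrow> has_zero_kernel C f \<Longrightarrow> is_mono C f"
    and k: "k \<in> Hom C X A" and l: "l \<in> Hom C Y A"
    and R: "is_equivalence_relation C A R r\<^sub>1 r\<^sub>2" and S: "is_equivalence_relation C A S s\<^sub>1 s\<^sub>2"
    and R_zero_class: "a \<in> Hom C T A \<Longrightarrow>
      related r\<^sub>1 r\<^sub>2 a (zero_arr C T A) \<longleftrightarrow> (\<exists>x \<in> Hom C T X. a = k \<cdot> x)"
    and S_zero_class: "a \<in> Hom C T A \<Longrightarrow>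
      related s\<^sub>1 s\<^sub>2 a (zero_arr C T A) \<longleftrightarrow> (\<exists>y \<in> Hom C T Y. a = l \<cdot> y)"
    and disjoint: "has_trivial_pullback C k l"
begin

lemma A_obj: "A \<in> Obj C" and X_obj: "X \<in> Obj C" and Y_obj: "Y \<in> Obj C"
  using Hom_objs k l by auto

lemma mono_if_kernel_zero:
  assumes "f \<in> Hom C B D"
    "\<And>T g. g \<in> Hom C T B \<Longrightarrow> f \<cdot> g = zero_arr C T D \<Longrightarrow> g = zero_arr C T B"
  shows "is_mono C f"
proof (rule zero_kernel_imp_mono)
  show "f \<in> Arr C" using assms(1) by (auto simp: Hom_iff)
  show "has_zero_kernel C f" by (rule has_zero_kernelI[OF assms])
qed

lemmas R_rel = equivalence_relation[OF R] and S_rel = equivalence_relation[OF S]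

text \<open>The first projection of the intersection of the two relations has kernel the intersection
  of their zero classes, so it is a monomorphism; being split by reflexivity, it is invertible.\<close>

lemma related_both_imp_eq:
  assumes a: "a \<in> Hom C T A" and Rab: "related r\<^sub>1 r\<^sub>2 a b" and Sab: "related s\<^sub>1 s\<^sub>2 a b"
  shows "a = b"
proof -
  note IA = Id_in_Hom[OF A_obj]
  obtain W w d where w: "w \<in> Hom C W A" and d: "d \<in> Hom C W A"
    and wd: "related r\<^sub>1 r\<^sub>2 (Id C A \<cdot> w) d" "related s\<^sub>1 s\<^sub>2 (Id C A \<cdot> w) d"
    and W: "\<And>T z e. z \<in> Hom C T A \<Longrightarrow> related r\<^sub>1 r\<^sub>2 (Id C A \<cdot> z) e \<Longrightarrow>
      related s\<^sub>1 s\<^sub>2 (Id C A \<cdot> z) e \<Longrightarrow> \<exists>h \<in> Hom C T W. w \<cdot> h = z \<and> d \<cdot> h = e"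
    and W_ext: "\<And>T h h'. h \<in> Hom C T W \<Longrightarrow> h' \<in> Hom C T W \<Longrightarrow> w \<cdot> h = w \<cdot> h' \<Longrightarrow> d \<cdot> h = d \<cdot> h' \<Longrightarrow>
      h = h'"
    by (rule comprehension_exists[OF R_rel S_rel IA IA], rule that)
  have wd': "related r\<^sub>1 r\<^sub>2 w d" "related s\<^sub>1 s\<^sub>2 w d" using wd Id_Comp[OF w] by auto
  have mono: "is_mono C w"
  proof (rule mono_if_kernel_zero[OF w])
    fix U g assume g: "g \<in> Hom C U W" and wg: "w \<cdot> g = zero_arr C U A"
    have U: "U \<in> Obj C" and WO: "W \<in> Obj C" using Hom_objs[OF g] by auto
    have z: "zero_arr C U A \<in> Hom C U A" using zero_arr_in_Hom[OF U A_obj] .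
    have dg: "d \<cdot> g \<in> Hom C U A" using Comp_in_Hom[OF g d] .
    \<comment> \<open>Over \<open>g\<close> the first end is 0, so the second end
      \<open>d \<cdot> g\<close> lies in both zero classes.\<close>
    have "related r\<^sub>1 r\<^sub>2 (d \<cdot> g) (zero_arr C U A)"
      using related_sym[OF R z] related_Comp[OF wd'(1) R_rel w g] wg by auto
    then obtain x where x: "x \<in> Hom C U X" "d \<cdot> g = k \<cdot> x" using R_zero_class[OF dg] by auto
    have "related s\<^sub>1 s\<^sub>2 (d \<cdot> g) (zero_arr C U A)"
      using related_sym[OF S z] related_Comp[OF wd'(2) S_rel w g] wg by auto
    then obtain y where y: "y \<in> Hom C U Y" "d \<cdot> g = l \<cdot> y" using S_zero_class[OF dg] by auto
    have "x = zero_arr C U X" using has_trivial_pullbackD(1)[OF disjoint k l x(1) y(1)] x y by auto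
    then have "d \<cdot> g = zero_arr C U A" using x Comp_zero_arr[OF k U] by auto
    then show "g = zero_arr C U W"
      using W_ext[OF g zero_arr_in_Hom[OF U WO]] wg Comp_zero_arr[OF w U] Comp_zero_arr[OF d U]
      by auto
  qed
  obtain e where e: "e \<in> Hom C A W" "w \<cdot> e = Id C A" "d \<cdot> e = Id C A"
    using W[OF IA] related_refl[OF R IA] related_refl[OF S IA] Comp_Id[OF IA] by auto
  obtain h where h: "h \<in> Hom C T W" "w \<cdot> h = a" "d \<cdot> h = b"
    using W[OF a] Rab Sab Id_Comp[OF a] by auto
  have "h = e \<cdot> a"
    using is_monoD[OF mono w h(1) Comp_in_Hom[OF a e(1)]] Comp_assoc[OF a e(1) w] e h Id_Comp[OF a]
    by auto
  then show ?thesis using Comp_assoc[OF a e(1) d] e h Id_Comp[OF a] by auto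
qed

text \<open>Two solutions are \<open>R\<close>-related through \<open>a\<close> and
  \<open>S\<close>-related through \<open>b\<close>, hence equal.\<close>

lemma related_both_unique:
  assumes a: "a \<in> Hom C T A" and b: "b \<in> Hom C T A"
    and c: "related r\<^sub>1 r\<^sub>2 a c" "related s\<^sub>1 s\<^sub>2 b c"
    and d: "related r\<^sub>1 r\<^sub>2 a d" "related s\<^sub>1 s\<^sub>2 b d"
  shows "c = d"
proof -
  have cH: "c \<in> Hom C T A" using related_in_Hom[OF c(1) R_rel a] .
  show ?thesis
    using related_both_imp_eq[OF cH] related_trans[OF R cH related_sym[OF R a c(1)] d(1)]
      related_trans[OF S cH related_sym[OF S b c(2)] d(2)] by auto
qed

text \<open>Since \<open>e\<close> is determined by \<open>z\<close>, forgetting it loses nothing: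
  the existence of \<open>e\<close> defines a subobject of \<open>Q\<close>.\<close>

lemma mono_comprehension_exists:
  assumes f: "f \<in> Hom C Q A" and g: "g \<in> Hom C Q A"
  obtains W w d where "w \<in> Hom C W Q" "is_mono C w" "d \<in> Hom C W A"
    "related r\<^sub>1 r\<^sub>2 (f \<cdot> w) d" "related s\<^sub>1 s\<^sub>2 (g \<cdot> w) d"
    "\<And>T z e. z \<in> Hom C T Q \<Longrightarrow> related r\<^sub>1 r\<^sub>2 (f \<cdot> z) e \<Longrightarrow> related s\<^sub>1 s\<^sub>2 (g \<cdot> z) e \<Longrightarrow>
       \<exists>h \<in> Hom C T W. w \<cdot> h = z \<and> d \<cdot> h = e"
proof -
  obtain W w d where w: "w \<in> Hom C W Q" and d: "d \<in> Hom C W A"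
    and fw: "related r\<^sub>1 r\<^sub>2 (f \<cdot> w) d" and gw: "related s\<^sub>1 s\<^sub>2 (g \<cdot> w) d"
    and W: "\<And>T z e. z \<in> Hom C T Q \<Longrightarrow> related r\<^sub>1 r\<^sub>2 (f \<cdot> z) e \<Longrightarrow> related s\<^sub>1 s\<^sub>2 (g \<cdot> z) e \<Longrightarrow>
       \<exists>h \<in> Hom C T W. w \<cdot> h = z \<and> d \<cdot> h = e"
    and W_ext: "\<And>T h h'. h \<in> Hom C T W \<Longrightarrow> h' \<in> Hom C T W \<Longrightarrow> w \<cdot> h = w \<cdot> h' \<Longrightarrow> d \<cdot> h = d \<cdot> h' \<Longrightarrow>
      h = h'"
    by (rule comprehension_exists[OF R_rel S_rel f g], rule that)
  have "is_mono C w"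
  proof (rule is_monoI[OF w])
    fix T a b assume a: "a \<in> Hom C T W" and b: "b \<in> Hom C T W" and eq: "w \<cdot> a = w \<cdot> b"
    have wa: "w \<cdot> a \<in> Hom C T Q" using Comp_in_Hom[OF a w] .
    have "related r\<^sub>1 r\<^sub>2 (f \<cdot> (w \<cdot> a)) (d \<cdot> a)" "related s\<^sub>1 s\<^sub>2 (g \<cdot> (w \<cdot> a)) (d \<cdot> a)"
      "related r\<^sub>1 r\<^sub>2 (f \<cdot> (w \<cdot> a)) (d \<cdot> b)" "related s\<^sub>1 s\<^sub>2 (g \<cdot> (w \<cdot> a)) (d \<cdot> b)"
      using related_Comp[OF fw R_rel Comp_in_Hom[OF w f] a]
        related_Comp[OF gw S_rel Comp_in_Hom[OF w g] a]
        related_Comp[OF fw R_rel Comp_in_Hom[OF w f] b]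
        related_Comp[OF gw S_rel Comp_in_Hom[OF w g] b]
        Comp_assoc[OF a w f] Comp_assoc[OF a w g] Comp_assoc[OF b w f] Comp_assoc[OF b w g] eq
      by auto
    then have "d \<cdot> a = d \<cdot> b"
      using related_both_unique[OF Comp_in_Hom[OF wa f] Comp_in_Hom[OF wa g]] by auto
    then show "a = b" using W_ext[OF a b eq] by auto
  qed
  then show thesis using that[OF w _ d fw gw W] by auto
qed

end

text \<open>The product is a parameter because cooperators are taken relative to an arbitrary
  product.\<close>

locale disjoint_zero_classes_product = disjoint_zero_classes +
  fixes P p q
  assumes P: "is_product C X Y P p q"
begin

lemma p: "p \<in> Hom C P X" and q: "q \<in> Hom C P Y"
  using P by (auto simp: is_product_def)

lemma kp: "k \<cdot> p \<in> Hom C P A" and lq: "l \<cdot> q \<in> Hom C P A"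
  using Comp_in_Hom[OF p k] Comp_in_Hom[OF q l] .

lemmas inX = pairing[OF P Id_in_Hom[OF X_obj] zero_arr_in_Hom[OF X_obj Y_obj]]
  and inY = pairing[OF P zero_arr_in_Hom[OF Y_obj X_obj] Id_in_Hom[OF Y_obj]]

text \<open>On the axis \<open>X\<close>, \<open>l q\<close> becomes 0 and \<open>k p\<close>
  becomes \<open>k\<close>, so one relation is the zero class of \<open>R\<close> and the other is
  reflexivity of \<open>S\<close>; on \<open>Y\<close> the roles are exchanged.\<close>

lemma axes_related:
  "related r\<^sub>1 r\<^sub>2 ((l \<cdot> q) \<cdot> pairing C p q (Id C X) (zero_arr C X Y)) k"
  "related s\<^sub>1 s\<^sub>2 ((k \<cdot> p) \<cdot> pairing C p q (Id C X) (zero_arr C X Y)) k"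
  "related r\<^sub>1 r\<^sub>2 ((l \<cdot> q) \<cdot> pairing C p q (zero_arr C Y X) (Id C Y)) l"
  "related s\<^sub>1 s\<^sub>2 ((k \<cdot> p) \<cdot> pairing C p q (zero_arr C Y X) (Id C Y)) l"
proof -
  have eqs: "(l \<cdot> q) \<cdot> pairing C p q (Id C X) (zero_arr C X Y) = zero_arr C X A"
    "(k \<cdot> p) \<cdot> pairing C p q (Id C X) (zero_arr C X Y) = k"
    "(l \<cdot> q) \<cdot> pairing C p q (zero_arr C Y X) (Id C Y) = l"
    "(k \<cdot> p) \<cdot> pairing C p q (zero_arr C Y X) (Id C Y) = zero_arr C Y A"
    using Comp_assoc[OF inX(1) q l] Comp_assoc[OF inX(1) p k] Comp_assoc[OF inY(1) q l]
      Comp_assoc[OF inY(1) p k] inX inY Comp_zero_arr[OF k Y_obj] Comp_zero_arr[OF l X_obj]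
      Comp_Id[OF k] Comp_Id[OF l] by auto
  have "related r\<^sub>1 r\<^sub>2 k (zero_arr C X A)"
    using R_zero_class[OF k] Comp_Id[OF k] Id_in_Hom[OF X_obj] by metis
  then show "related r\<^sub>1 r\<^sub>2 ((l \<cdot> q) \<cdot> pairing C p q (Id C X) (zero_arr C X Y)) k"
    unfolding eqs by (rule related_sym[OF R k])
  have "related s\<^sub>1 s\<^sub>2 l (zero_arr C Y A)"
    using S_zero_class[OF l] Comp_Id[OF l] Id_in_Hom[OF Y_obj] by metis
  then show "related s\<^sub>1 s\<^sub>2 ((k \<cdot> p) \<cdot> pairing C p q (zero_arr C Y X) (Id C Y)) l"
    unfolding eqs by (rule related_sym[OF S l])
  show "related s\<^sub>1 s\<^sub>2 ((k \<cdot> p) \<cdot> pairing C p q (Id C X) (zero_arr C X Y)) k"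
    "related r\<^sub>1 r\<^sub>2 ((l \<cdot> q) \<cdot> pairing C p q (zero_arr C Y X) (Id C Y)) l"
    unfolding eqs using related_refl[OF S k] related_refl[OF R l] .
qed

text \<open>Elementwise, \<open>\<phi>(x, y)\<close> is the fourth vertex of the parallelogram with sides
  \<open>0 R k x\<close>, \<open>0 S l y\<close>, \<open>l y R \<phi>(x, y)\<close> and \<open>k x S \<phi>(x, y)\<close>.\<close>

lemma fourth_vertex_exists:
  obtains \<phi> where "\<phi> \<in> Hom C P A" "related r\<^sub>1 r\<^sub>2 (l \<cdot> q) \<phi>" "related s\<^sub>1 s\<^sub>2 (k \<cdot> p) \<phi>"
proof -
  \<comment> \<open>\<open>W\<close> is the part of \<open>P\<close> on which a fourth vertex
    exists, and \<open>d\<close> is that vertex.\<close>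
  obtain W w d where w: "w \<in> Hom C W P" "is_mono C w" and d: "d \<in> Hom C W A"
    and rd: "related r\<^sub>1 r\<^sub>2 ((l \<cdot> q) \<cdot> w) d" and sd: "related s\<^sub>1 s\<^sub>2 ((k \<cdot> p) \<cdot> w) d"
    and W: "\<And>T z e. z \<in> Hom C T P \<Longrightarrow> related r\<^sub>1 r\<^sub>2 ((l \<cdot> q) \<cdot> z) e \<Longrightarrow>
      related s\<^sub>1 s\<^sub>2 ((k \<cdot> p) \<cdot> z) e \<Longrightarrow> \<exists>h \<in> Hom C T W. w \<cdot> h = z \<and> d \<cdot> h = e"
    by (rule mono_comprehension_exists[OF lq kp], rule that)
  obtain h\<^sub>1 where h\<^sub>1: "h\<^sub>1 \<in> Hom C X W" "w \<cdot> h\<^sub>1 = pairing C p q (Id C X) (zero_arr C X Y)"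
    using W[OF inX(1) axes_related(1,2)] by auto
  obtain h\<^sub>2 where h\<^sub>2: "h\<^sub>2 \<in> Hom C Y W" "w \<cdot> h\<^sub>2 = pairing C p q (zero_arr C Y X) (Id C Y)"
    using W[OF inY(1) axes_related(3,4)] by auto
  obtain h where h: "h \<in> Hom C P W" "w \<cdot> h = Id C P"
    using axes_jointly_strongly_epic[OF P w h\<^sub>1 h\<^sub>2] .
  have "((l \<cdot> q) \<cdot> w) \<cdot> h = l \<cdot> q" "((k \<cdot> p) \<cdot> w) \<cdot> h = k \<cdot> p"
    using Comp_assoc[OF h(1) w(1) lq] Comp_assoc[OF h(1) w(1) kp] h Comp_Id[OF lq] Comp_Id[OF kp]
    by auto
  then show thesis
    using that[OF Comp_in_Hom[OF h(1) d]] related_Comp[OF rd R_rel Comp_in_Hom[OF w(1) lq] h(1)]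
      related_Comp[OF sd S_rel Comp_in_Hom[OF w(1) kp] h(1)] by auto
qed

section \<open>The arrow formed by the fourth vertices\<close>

context
  fixes \<phi>
  assumes \<phi>: "\<phi> \<in> Hom C P A" and r\<phi>: "related r\<^sub>1 r\<^sub>2 (l \<cdot> q) \<phi>" and s\<phi>: "related s\<^sub>1 s\<^sub>2 (k \<cdot> p) \<phi>"
begin

lemma fourth_vertex_related:
  assumes z: "z \<in> Hom C T P"
  shows "related r\<^sub>1 r\<^sub>2 ((l \<cdot> q) \<cdot> z) (\<phi> \<cdot> z)" "related s\<^sub>1 s\<^sub>2 ((k \<cdot> p) \<cdot> z) (\<phi> \<cdot> z)"
  using related_Comp[OF r\<phi> R_rel lq z] related_Comp[OF s\<phi> S_rel kp z] .

lemma fourth_vertex_unique: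
  assumes z: "z \<in> Hom C T P"
    and "related r\<^sub>1 r\<^sub>2 ((l \<cdot> q) \<cdot> z) e" "related s\<^sub>1 s\<^sub>2 ((k \<cdot> p) \<cdot> z) e"
  shows "\<phi> \<cdot> z = e"
  using related_both_unique[OF Comp_in_Hom[OF z lq] Comp_in_Hom[OF z kp]
      fourth_vertex_related[OF z]] assms(2,3) by auto

lemma fourth_vertex_axes:
  "\<phi> \<cdot> pairing C p q (Id C X) (zero_arr C X Y) = k"
  "\<phi> \<cdot> pairing C p q (zero_arr C Y X) (Id C Y) = l"
  using fourth_vertex_unique[OF inX(1) axes_related(1,2)]
    fourth_vertex_unique[OF inY(1) axes_related(3,4)] .

text \<open>If \<open>\<phi>(x, y)\<close> is 0, then \<open>l y R 0\<close> puts \<open>l y\<close>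
  into the image of \<open>k\<close>, and \<open>k x S 0\<close> puts \<open>k x\<close> into that
  of \<open>l\<close>. The trivial pullback forces both \<open>x\<close> and \<open>y\<close> to be
  0.\<close>

lemma fourth_vertex_mono: "is_mono C \<phi>"
proof (rule mono_if_kernel_zero[OF \<phi>])
  fix T z assume z: "z \<in> Hom C T P" and "\<phi> \<cdot> z = zero_arr C T A"
  then have r: "related r\<^sub>1 r\<^sub>2 (l \<cdot> (q \<cdot> z)) (zero_arr C T A)"
    and s: "related s\<^sub>1 s\<^sub>2 (k \<cdot> (p \<cdot> z)) (zero_arr C T A)"
    using fourth_vertex_related[OF z] Comp_assoc[OF z q l] Comp_assoc[OF z p k] by auto
  have pz: "p \<cdot> z \<in> Hom C T X" and qz: "q \<cdot> z \<in> Hom C T Y"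
    using Comp_in_Hom[OF z p] Comp_in_Hom[OF z q] .
  have T: "T \<in> Obj C" and PO: "P \<in> Obj C" using Hom_objs[OF z] by auto
  obtain x where x: "x \<in> Hom C T X" "l \<cdot> (q \<cdot> z) = k \<cdot> x"
    using r R_zero_class[OF Comp_in_Hom[OF qz l]] by auto
  obtain y where y: "y \<in> Hom C T Y" "k \<cdot> (p \<cdot> z) = l \<cdot> y"
    using s S_zero_class[OF Comp_in_Hom[OF pz k]] by auto
  have "q \<cdot> z = zero_arr C T Y" "p \<cdot> z = zero_arr C T X"
    using has_trivial_pullbackD(2)[OF disjoint k l x(1) qz x(2)[symmetric]]
      has_trivial_pullbackD(1)[OF disjoint k l pz y(1) y(2)] .
  then show "z = zero_arr C T P"
    using product_ext[OF P z zero_arr_in_Hom[OF T PO]] Comp_zero_arr[OF p T] Comp_zero_arr[OF q T]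
    by auto
qed

text \<open>\<open>\<phi>\<close> is the zero class of the composite of \<open>R\<close> and \<open>S\<close>, which exists as a relation since
  the intermediate element is unique, and is an equivalence relation since it is reflexive.\<close>

lemma fourth_vertex_bourn_normal: "is_bourn_normal_mono C \<phi>"
proof -
  obtain Q a\<^sub>1 a\<^sub>2 where Q: "is_product C A A Q a\<^sub>1 a\<^sub>2" using product_exists[OF A_obj A_obj] .
  have a: "a\<^sub>1 \<in> Hom C Q A" "a\<^sub>2 \<in> Hom C Q A" using Q by (auto simp: is_product_def)
  obtain W w d where w: "w \<in> Hom C W Q" "is_mono C w" and d: "d \<in> Hom C W A"
    and rd: "related r\<^sub>1 r\<^sub>2 (a\<^sub>1 \<cdot> w) d" and sd: "related s\<^sub>1 s\<^sub>2 (a\<^sub>2 \<cdot> w) d"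
    and W: "\<And>T z e. z \<in> Hom C T Q \<Longrightarrow> related r\<^sub>1 r\<^sub>2 (a\<^sub>1 \<cdot> z) e \<Longrightarrow>
      related s\<^sub>1 s\<^sub>2 (a\<^sub>2 \<cdot> z) e \<Longrightarrow> \<exists>h \<in> Hom C T W. w \<cdot> h = z \<and> d \<cdot> h = e"
    by (rule mono_comprehension_exists[OF a], rule that)
  define t\<^sub>1 t\<^sub>2 where "t\<^sub>1 = a\<^sub>1 \<cdot> w" and "t\<^sub>2 = a\<^sub>2 \<cdot> w"
  have t: "t\<^sub>1 \<in> Hom C W A" "t\<^sub>2 \<in> Hom C W A"
    unfolding t\<^sub>1_def t\<^sub>2_def using Comp_in_Hom[OF w(1) a(1)] Comp_in_Hom[OF w(1) a(2)] .
  have aw: "a\<^sub>1 \<cdot> (w \<cdot> h) = t\<^sub>1 \<cdot> h" "a\<^sub>2 \<cdot> (w \<cdot> h) = t\<^sub>2 \<cdot> h" if "h \<in> Hom C T W" for T h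
    unfolding t\<^sub>1_def t\<^sub>2_def using Comp_assoc[OF that w(1) a(1)] Comp_assoc[OF that w(1) a(2)]
    by auto
  \<comment> \<open>The half in \<open>S\<close> points backwards, as the comprehension provides it;
    symmetry of \<open>S\<close> makes this the usual composite.\<close>
  have related_iff: "related t\<^sub>1 t\<^sub>2 b c \<longleftrightarrow> (\<exists>e. related r\<^sub>1 r\<^sub>2 b e \<and> related s\<^sub>1 s\<^sub>2 c e)"
    if b: "b \<in> Hom C T A" and c: "c \<in> Hom C T A" for T b c
  proof
    assume "related t\<^sub>1 t\<^sub>2 b c"
    then obtain h where h: "h \<in> Hom C T W" "t\<^sub>1 \<cdot> h = b" "t\<^sub>2 \<cdot> h = c"
      using relatedE[OF _ b t(1)] by metis
    then show "\<exists>e. related r\<^sub>1 r\<^sub>2 b e \<and> related s\<^sub>1 s\<^sub>2 c e"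
      using related_Comp[OF rd R_rel _ h(1)] related_Comp[OF sd S_rel _ h(1)] t
      unfolding t\<^sub>1_def t\<^sub>2_def by auto
  next
    assume "\<exists>e. related r\<^sub>1 r\<^sub>2 b e \<and> related s\<^sub>1 s\<^sub>2 c e"
    then obtain e where e: "related r\<^sub>1 r\<^sub>2 b e" "related s\<^sub>1 s\<^sub>2 c e" by auto
    note bc = pairing[OF Q b c]
    obtain h where h: "h \<in> Hom C T W" "w \<cdot> h = pairing C a\<^sub>1 a\<^sub>2 b c"
      using W[OF bc(1)] bc e by auto
    show "related t\<^sub>1 t\<^sub>2 b c" using relatedI[OF h(1) t(1)] aw[OF h(1)] h bc by auto
  qed
  have rel: "is_relation C A W t\<^sub>1 t\<^sub>2"
    unfolding is_relation_def
  proof (intro conjI allI ballI impI t)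
    fix T f g assume f: "f \<in> Hom C T W" and g: "g \<in> Hom C T W"
      and eq: "t\<^sub>1 \<cdot> f = t\<^sub>1 \<cdot> g \<and> t\<^sub>2 \<cdot> f = t\<^sub>2 \<cdot> g"
    have "w \<cdot> f = w \<cdot> g"
      using product_ext[OF Q Comp_in_Hom[OF f w(1)] Comp_in_Hom[OF g w(1)]] aw[OF f] aw[OF g] eq
      by auto
    then show "f = g" by (rule is_monoD[OF w(2,1) f g])
  qed
  note IA = Id_in_Hom[OF A_obj]
  have "related t\<^sub>1 t\<^sub>2 (Id C A) (Id C A)"
    using related_iff[OF IA IA] related_refl[OF R IA] related_refl[OF S IA] by auto
  then have "is_reflexive_relation C A W t\<^sub>1 t\<^sub>2"
    unfolding is_reflexive_relation_def using rel relatedE[OF _ IA t(1)] by metis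
  then have E: "is_equivalence_relation C A W t\<^sub>1 t\<^sub>2" by (rule reflexive_imp_equivalence)
  show ?thesis
  proof (rule bourn_normal_monoI[OF \<phi> fourth_vertex_mono Q E])
    fix T b assume b: "b \<in> Hom C T A"
    have T: "T \<in> Obj C" using Hom_objs[OF b] by auto
    have z: "zero_arr C T A \<in> Hom C T A" using zero_arr_in_Hom[OF T A_obj] .
    show "related t\<^sub>1 t\<^sub>2 b (zero_arr C T A) \<longleftrightarrow> (\<exists>x \<in> Hom C T P. b = \<phi> \<cdot> x)"
    proof
      assume b0: "related t\<^sub>1 t\<^sub>2 b (zero_arr C T A)"
      then obtain c where c: "related r\<^sub>1 r\<^sub>2 b c" "related s\<^sub>1 s\<^sub>2 (zero_arr C T A) c"
        using related_iff[OF b z] by auto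
      have cH: "c \<in> Hom C T A" using related_in_Hom[OF c(1) R_rel b] .
      obtain y where y: "y \<in> Hom C T Y" "c = l \<cdot> y"
        using S_zero_class[OF cH] related_sym[OF S z c(2)] by auto
      \<comment> \<open>Symmetry of the composite supplies the opposite corner: \<open>c\<close>
        gives the coordinate in \<open>Y\<close>, \<open>e\<close> the one in \<open>X\<close>, and
        \<open>b\<close> is the fourth vertex over them.\<close>
      obtain e where e: "related r\<^sub>1 r\<^sub>2 (zero_arr C T A) e" "related s\<^sub>1 s\<^sub>2 b e"
        using related_iff[OF z b] related_sym[OF E b b0] by auto
      have eH: "e \<in> Hom C T A" using related_in_Hom[OF e(1) R_rel z] .
      obtain x where x: "x \<in> Hom C T X" "e = k \<cdot> x"
        using R_zero_class[OF eH] related_sym[OF R z e(1)] by auto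
      note xy = pairing[OF P x(1) y(1)]
      have "(l \<cdot> q) \<cdot> pairing C p q x y = c" "(k \<cdot> p) \<cdot> pairing C p q x y = e"
        using Comp_assoc[OF xy(1) q l] Comp_assoc[OF xy(1) p k] xy x y by auto
      then have "\<phi> \<cdot> pairing C p q x y = b"
        using fourth_vertex_unique[OF xy(1)] related_sym[OF R b c(1)] related_sym[OF S b e(2)]
        by auto
      then show "\<exists>x \<in> Hom C T P. b = \<phi> \<cdot> x" using xy(1) by auto
    next
      assume "\<exists>x \<in> Hom C T P. b = \<phi> \<cdot> x"
      then obtain v where v: "v \<in> Hom C T P" "b = \<phi> \<cdot> v" by auto
      have lqv: "(l \<cdot> q) \<cdot> v \<in> Hom C T A" using Comp_in_Hom[OF v(1) lq] .
      \<comment> \<open>The corner \<open>l (q v)\<close> is the intermediate element between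
        \<open>\<phi> v\<close> and 0.\<close>
      have "related s\<^sub>1 s\<^sub>2 ((l \<cdot> q) \<cdot> v) (zero_arr C T A)"
        using S_zero_class[OF lqv] Comp_assoc[OF v(1) q l] Comp_in_Hom[OF v(1) q] by auto
      then have "related s\<^sub>1 s\<^sub>2 (zero_arr C T A) ((l \<cdot> q) \<cdot> v)" by (rule related_sym[OF S lqv])
      moreover have "related r\<^sub>1 r\<^sub>2 b ((l \<cdot> q) \<cdot> v)"
        using related_sym[OF R lqv fourth_vertex_related(1)[OF v(1)]] v by auto
      ultimately show "related t\<^sub>1 t\<^sub>2 b (zero_arr C T A)" using related_iff[OF b z] by auto
    qed
  qed
qed

text \<open>Any upper bound \<open>m\<close> of \<open>k\<close> and \<open>l\<close> factors
  \<open>\<phi>\<close> on both axes, hence on all of \<open>P\<close>.\<close>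

lemma fourth_vertex_is_join: "is_join C A k l \<phi>"
  unfolding is_join_def
proof (intro conjI allI impI)
  have D: "Dom C k = X" "Dom C l = Y" "Dom C \<phi> = P" using k l \<phi> by (auto simp: Hom_iff)
  show "is_mono C \<phi>" by (rule fourth_vertex_mono)
  show "Cod C \<phi> = A" using \<phi> by (auto simp: Hom_iff)
  show "sub_le C k \<phi>" "sub_le C l \<phi>"
    unfolding sub_le_def D using inX(1) inY(1) fourth_vertex_axes by auto
  fix m assume m: "is_mono C m \<and> Cod C m = A \<and> sub_le C k m \<and> sub_le C l m"
  then have mH: "m \<in> Hom C (Dom C m) A" by (auto simp: Hom_iff is_mono_def)
  obtain f where f: "f \<in> Hom C X (Dom C m)" "m \<cdot> f = k" using m D by (auto simp: sub_le_def)
  obtain g where g: "g \<in> Hom C Y (Dom C m)" "m \<cdot> g = l" using m D by (auto simp: sub_le_def)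
  obtain h where "h \<in> Hom C P (Dom C m)" "m \<cdot> h = \<phi>"
    using factors_if_axes_factor[OF P \<phi> mH _ f(1) _ g(1)] m f g fourth_vertex_axes by metis
  then show "sub_le C \<phi> m" unfolding sub_le_def D by auto
qed

end

section \<open>Cooperators are fourth vertices\<close>

lemma is_cooperator_iff:
  "is_cooperator C P p q k l \<phi> \<longleftrightarrow> \<phi> \<in> Hom C P A \<and>
     \<phi> \<cdot> pairing C p q (Id C X) (zero_arr C X Y) = k \<and>
     \<phi> \<cdot> pairing C p q (zero_arr C Y X) (Id C Y) = l"
proof -
  have "Dom C k = X" "Dom C l = Y" "Cod C k = A" "k \<in> Arr C" using k l by (auto simp: Hom_iff)
  then show ?thesis unfolding is_cooperator_def Let_def using l P by auto
qed

lemma cooperator_exists: "\<exists>\<phi>. is_cooperator C P p q k l \<phi>"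
  using fourth_vertex_exists fourth_vertex_axes unfolding is_cooperator_iff by metis

text \<open>An arbitrary cooperator agrees with the constructed arrow on both axes, so it is that
  arrow.\<close>

lemma cooperator_bourn_normal_join:
  assumes "is_cooperator C P p q k l \<phi>"
  shows "is_bourn_normal_mono C \<phi> \<and> is_join C A k l \<phi>"
proof -
  obtain \<psi> where \<psi>: "\<psi> \<in> Hom C P A" "related r\<^sub>1 r\<^sub>2 (l \<cdot> q) \<psi>" "related s\<^sub>1 s\<^sub>2 (k \<cdot> p) \<psi>"
    using fourth_vertex_exists .
  have "\<phi> = \<psi>"
    using axes_jointly_epic[OF P _ \<psi>(1)] fourth_vertex_axes[OF \<psi>] assms
    unfolding is_cooperator_iff by auto
  then show ?thesis using fourth_vertex_bourn_normal[OF \<psi>] fourth_vertex_is_join[OF \<psi>] by auto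
qed

end

theorem theorem3p14:
  fixes C :: "('o, 'a) category"
    and X Y A :: 'o
    and k l :: 'a
  assumes "pointed_maltsev_category C"
    and "\<forall>f \<in> Arr C. is_mono C f \<longleftrightarrow> has_zero_kernel C f"
    and "k \<in> Hom C X A" and "is_bourn_normal_mono C k"
    and "l \<in> Hom C Y A" and "is_bourn_normal_mono C l"
    and "has_trivial_pullback C k l"
  shows "huq_commute C k l \<and>
    (\<forall>P p q \<phi>. is_cooperator C P p q k l \<phi> \<longrightarrow>
       is_bourn_normal_mono C \<phi> \<and> is_join C A k l \<phi>)"
proof -
  interpret pointed_maltsev_category C by (rule assms(1))
  obtain R r\<^sub>1 r\<^sub>2 where R: "is_equivalence_relation C A R r\<^sub>1 r\<^sub>2"
    "\<And>T a. a \<in> Hom C T A \<Longrightarrow>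
      related r\<^sub>1 r\<^sub>2 a (zero_arr C T A) \<longleftrightarrow> (\<exists>x \<in> Hom C T X. a = k \<cdot>\<^bsub>C\<^esub> x)"
    by (rule bourn_normal_monoE[OF assms(4,3)], rule that)
  obtain S s\<^sub>1 s\<^sub>2 where S: "is_equivalence_relation C A S s\<^sub>1 s\<^sub>2"
    "\<And>T a. a \<in> Hom C T A \<Longrightarrow>
      related s\<^sub>1 s\<^sub>2 a (zero_arr C T A) \<longleftrightarrow> (\<exists>y \<in> Hom C T Y. a = l \<cdot>\<^bsub>C\<^esub> y)"
    by (rule bourn_normal_monoE[OF assms(6,5)], rule that)
  interpret disjoint_zero_classes C X Y A k l R r\<^sub>1 r\<^sub>2 S s\<^sub>1 s\<^sub>2
    by unfold_locales (use assms R S in auto)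
  \<comment> \<open>One product suffices for Huq-commutation, but each cooperator comes with a
    product of its own, so the statement is proved for all of them.\<close>
  have coop: "(\<exists>\<phi>. is_cooperator C P p q k l \<phi>) \<and>
      (\<forall>\<phi>. is_cooperator C P p q k l \<phi> \<longrightarrow> is_bourn_normal_mono C \<phi> \<and> is_join C A k l \<phi>)"
    if P: "is_product C X Y P p q" for P p q
  proof -
    interpret disjoint_zero_classes_product C X Y A k l R r\<^sub>1 r\<^sub>2 S s\<^sub>1 s\<^sub>2 P p q
      by unfold_locales (rule P)
    show ?thesis using cooperator_exists cooperator_bourn_normal_join by auto
  qed
  obtain P p q where "is_product C X Y P p q" using product_exists[OF X_obj Y_obj] .
  then have "huq_commute C k l" unfolding huq_commute_def using coop by blast
  moreover have "is_product C X Y P p q" if "is_cooperator C P p q k l \<phi>" for P p q \<phi>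
    using that assms(3,5) by (auto simp: is_cooperator_def Let_def Hom_iff)
  ultimately show ?thesis using coop by blast
qed

end
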